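(* Let $b>1$ be an integer. Let $P$ be a finite set of primes, each coprime to $b$, and let $(c_k)_{k\ge1}$ be a strictly increasing sequence of positive integers such that every prime dividing any $c_k$ lies in $P$ and $c_k\mid c_{k+1}$ for all $k$. Let $(m_k)_{k\ge1}$ be a strictly increasing sequence of positive integers and put $\mu_k=m_k-m_{k-1}$ (with $m_0=0$). Suppose there exists $\epsilon>0$ such that \[ \lim_{k\to\infty}\frac{\exp\!\left((1+\epsilon)\log c_k/\log\log c_k\right)}{\mu_k}=0. \] Then the number \[ \alpha_{b,c,m}=\sum_{k=1}^\infty\frac{1}{c_kb^{m_k}} \] is normal in base $b$.
   Context: A real number $x$ with base-$b$ expansion $0.a_1a_2a_3\dots$ (integer part ignored) is normal in base $b$ if for every finite string $s=[d_1,\dots,d_k]$ of base-$b$ digits, $\lim_{N\to\infty}\frac{1}{N}\#\{1\le n\le N: a_{n-1+i}=d_i\text{ for }1\le i\le k\}=b^{-k}$. $\log$ is the natural logarithm. *)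

theory Defs
  imports "HOL-Analysis.Analysis" "HOL-Computational_Algebra.Primes"
begin

text \<open>
  For \<open>n \<ge> 1\<close>, the \<open>n\<close>-th digit \<open>a\<^sub>n\<close> after the point in the base-\<open>b\<close> expansion of the fractional
  part of \<open>x\<close>. A number with two expansions gets the one that does not end in digits \<open>b - 1\<close>;
  both expansions of such a number are eventually constant, so the choice does not affect normality.
\<close>

definition base_digit :: "nat \<Rightarrow> real \<Rightarrow> nat \<Rightarrow> nat" where
  "base_digit b x n = nat (\<lfloor>frac x * real b ^ n\<rfloor> mod int b)"

definition normal_in_base :: "nat \<Rightarrow> real \<Rightarrow> bool" where
  "normal_in_base b x \<longleftrightarrow>
     (\<forall>s :: nat list. set s \<subseteq> {0..<b} \<longrightarrow>
        (\<lambda>N. real (card {n \<in> {1..N}. \<forall>i\<in>{1..length s}. base_digit b x (n - 1 + i) = s ! (i - 1)})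
               / real N)
          \<longlonglongrightarrow> 1 / real b ^ length s)"

text \<open>
  The sequences \<open>c\<close> and \<open>m\<close> are indexed from 1, hence the shift by \<open>Suc\<close>.
\<close>

definition alpha :: "nat \<Rightarrow> (nat \<Rightarrow> nat) \<Rightarrow> (nat \<Rightarrow> nat) \<Rightarrow> real" where
  "alpha b c m = (\<Sum>k. 1 / (real (c (Suc k)) * real b ^ m (Suc k)))"

end

theory Submission
  imports Defs "HOL-Number_Theory.Residues" "HOL-Real_Asymp.Real_Asymp"
begin

text \<open>
  On the block \<open>m\<^sub>k \<le> n < m\<^sub>k\<^sub>+\<^sub>1\<close> the fractional part of \<open>b\<^sup>n \<alpha>\<close> is that of \<open>a b\<^sup>i / D + o(1)\<close>, where
  \<open>i = n - m\<^sub>k\<close> and \<open>D\<close> is the reduced denominator of the \<open>k\<close>-th partial sum. Although \<open>D\<close> can be much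
  smaller than \<open>c\<^sub>k\<close>, it tends to infinity. By Weyl's criterion it suffices to bound the exponential sums
  of \<open>a b\<^sup>i / D\<close> over \<open>i < N\<close>, where \<open>N\<close> may be as small as \<open>D\<close> to the power \<open>(1 + \<epsilon>) / log log D\<close>.

  Choose \<open>T0\<close> with \<open>b ^ T0\<close> equal to \<open>1\<close> modulo \<open>p\<^sup>2\<close> for all \<open>p \<in> P\<close>. By the lifting-the-exponent lemma,
  \<open>b ^ (T0 * M * l) - 1\<close> and \<open>(b ^ T0 - 1) * M * l\<close> have the same divisors composed of primes in \<open>P\<close>.
  Hence a van der Corput step with shifts that are multiples of \<open>T0 * M\<close>, where \<open>M\<close> divides \<open>D\<close>,
  replaces \<open>D\<close> by a modulus smaller by a factor of about \<open>M\<close>. After about \<open>log log D / (1 + \<epsilon> / 2)\<close> steps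
  the modulus is below \<open>N\<close>, and there the sums over full periods vanish. Since \<open>log 2 < 1\<close>, the square
  roots lost along the way do not destroy the bound.
\<close>

section \<open>Divisibility of \<open>x ^ m - 1\<close> by smooth numbers\<close>

text \<open>Peel off one prime factor \<open>q\<close> of the exponent at a time:
  \<open>x ^ q - 1 = (x - 1) * s\<close>, where \<open>s\<close> is a sum of \<open>q\<close> powers
  of \<open>x\<close>, hence congruent to \<open>q\<close> modulo \<open>p^2\<close>. So
  \<open>p\<close> divides \<open>s\<close> exactly once if \<open>q = p\<close> and not at all
  otherwise. Working modulo \<open>p^2\<close> rather than \<open>p\<close> makes
  \<open>p = 2\<close> no exception. The induction hypothesis is applied to
  \<open>x ^ q\<close>.\<close>

lemma multiplicity_power_minus_one:
  fixes p x m :: nat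
  assumes "prime p" "[x = 1] (mod p\<^sup>2)" "x > 1" "m > 0"
  shows "multiplicity p (x ^ m - 1) = multiplicity p (x - 1) + multiplicity p m"
  using \<open>m > 0\<close> \<open>x > 1\<close> \<open>[x = 1] (mod p\<^sup>2)\<close>
proof (induction m arbitrary: x rule: prime_divisors_induct)
  case (factor q m)
  show ?case
  proof (cases "m > 0")
    case True
    define s where "s = (\<Sum>i<q. x ^ i)"
    have "x ^ q > 1"
      using factor.prems prime_gt_0_nat[OF \<open>prime q\<close>] by (intro one_less_power) auto
    moreover have xq: "[x ^ q = 1] (mod p\<^sup>2)"
      using cong_pow[OF factor.prems(3), of q] by simp
    ultimately have IH: "multiplicity p ((x ^ q) ^ m - 1) = multiplicity p (x ^ q - 1) + multiplicity p m"
      using factor.IH True by blast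
    have "int x ^ q - 1 = (int x - 1) * (\<Sum>i<q. int x ^ i)"
      by (rule power_diff_1_eq)
    hence "int (x ^ q - 1) = int ((x - 1) * s)"
      using \<open>x ^ q > 1\<close> \<open>x > 1\<close> by (simp add: s_def of_nat_diff)
    hence xs: "x ^ q - 1 = (x - 1) * s"
      by (simp only: of_nat_eq_iff)
    hence "s \<noteq> 0" using \<open>x ^ q > 1\<close> by (intro notI) simp
    have "[s = (\<Sum>i<q. 1)] (mod p\<^sup>2)"
      unfolding s_def by (intro cong_sum) (use cong_pow[OF factor.prems(3)] in simp)
    hence sq: "[s = q] (mod p\<^sup>2)" by simp
    have sq': "[s = q] (mod p)"
      using sq by (rule cong_dvd_modulus_nat) simp
    have "multiplicity p s = multiplicity p q"
    proof (cases "p = q")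
      case True
      have "p dvd s"
        using cong_dvd_iff[OF sq'] True by simp
      moreover have "\<not> p\<^sup>2 dvd s"
        using sq True prime_gt_1_nat[OF \<open>prime p\<close>]
        by (auto simp: power2_eq_square dest: cong_dvd_iff)
      ultimately have "multiplicity p s = 1"
        by (intro multiplicity_eqI) (auto simp: power2_eq_square)
      thus ?thesis using True \<open>prime p\<close> by (simp add: prime_imp_prime_elem)
    next
      case False
      have "\<not> p dvd q" using False \<open>prime q\<close> \<open>prime p\<close> primes_dvd_imp_eq by blast
      moreover from this have "\<not> p dvd s"
        using cong_dvd_iff[OF sq'] by simp
      ultimately show ?thesis by (simp add: not_dvd_imp_multiplicity_0)
    qed
    moreover have "multiplicity p ((x - 1) * s) = multiplicity p (x - 1) + multiplicity p s"
      using \<open>prime p\<close> \<open>s \<noteq> 0\<close> \<open>x > 1\<close>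
      by (intro prime_elem_multiplicity_mult_distrib) (auto simp: prime_imp_prime_elem)
    moreover have "multiplicity p (q * m) = multiplicity p q + multiplicity p m"
      using \<open>prime p\<close> \<open>prime q\<close> True
      by (intro prime_elem_multiplicity_mult_distrib) (auto simp: prime_imp_prime_elem)
    ultimately show ?thesis using IH xs by (simp add: power_mult)
  qed (use factor.prems in auto)
qed auto

text \<open>Positivity is demanded because \<open>prime_factors 0\<close> is empty, so that 0 would
  otherwise qualify.\<close>

definition supported_on :: "nat set \<Rightarrow> nat \<Rightarrow> bool" where
  "supported_on P d \<longleftrightarrow> d > 0 \<and> prime_factors d \<subseteq> P"

lemma supported_onD: "supported_on P d \<Longrightarrow> prime p \<Longrightarrow> p dvd d \<Longrightarrow> p \<in> P"
  by (auto simp: supported_on_def prime_factors_dvd)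

lemma supported_on_pos: "supported_on P d \<Longrightarrow> d > 0"
  by (simp add: supported_on_def)

lemma supported_on_dvd: "supported_on P d \<Longrightarrow> d' dvd d \<Longrightarrow> supported_on P d'"
  using dvd_prime_factors[of d d'] by (auto simp: supported_on_def intro!: Nat.gr0I)

text \<open>Both numbers have the same multiplicity at every prime of \<open>P\<close>, and no other
  prime divides \<open>d\<close>.\<close>

lemma dvd_power_minus_one_iff:
  fixes x m d :: nat
  assumes "\<And>p. p \<in> P \<Longrightarrow> prime p \<and> [x = 1] (mod p\<^sup>2)" "x > 1" "m > 0" "supported_on P d"
  shows "d dvd x ^ m - 1 \<longleftrightarrow> d dvd (x - 1) * m"
proof -
  have "x ^ m > 1" using assms by (intro one_less_power) auto
  have "multiplicity p (x ^ m - 1) = multiplicity p ((x - 1) * m)" if "p \<in> P" for p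
    using multiplicity_power_minus_one[of p x m] assms that
    by (simp add: prime_elem_multiplicity_mult_distrib prime_imp_prime_elem)
  hence *: "multiplicity p d \<le> multiplicity p (x ^ m - 1) \<longleftrightarrow>
       multiplicity p d \<le> multiplicity p ((x - 1) * m)" if "prime p" for p
    using assms(4) that
    by (cases "p dvd d") (auto dest: supported_onD simp: not_dvd_imp_multiplicity_0)
  show ?thesis
  proof
    assume "d dvd x ^ m - 1"
    hence "multiplicity p d \<le> multiplicity p (x ^ m - 1)" for p
      using \<open>x ^ m > 1\<close> by (intro dvd_imp_multiplicity_le) auto
    thus "d dvd (x - 1) * m"
      using * supported_on_pos[OF assms(4)] by (intro multiplicity_le_imp_dvd) auto
  next
    assume "d dvd (x - 1) * m"
    hence "multiplicity p d \<le> multiplicity p ((x - 1) * m)" for p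
      using \<open>x > 1\<close> \<open>m > 0\<close> by (intro dvd_imp_multiplicity_le) auto
    thus "d dvd x ^ m - 1"
      using * supported_on_pos[OF assms(4)] by (intro multiplicity_le_imp_dvd) auto
  qed
qed

lemma gcd_power_minus_one:
  fixes x m d :: nat
  assumes "\<And>p. p \<in> P \<Longrightarrow> prime p \<and> [x = 1] (mod p\<^sup>2)" "x > 1" "m > 0" "supported_on P d"
  shows "gcd d (x ^ m - 1) = gcd d ((x - 1) * m)"
proof (rule dvd_antisym)
  have *: "t dvd x ^ m - 1 \<longleftrightarrow> t dvd (x - 1) * m" if "t dvd d" for t
    using dvd_power_minus_one_iff[OF assms(1-3) supported_on_dvd[OF assms(4) that]] by blast
  show "gcd d (x ^ m - 1) dvd gcd d ((x - 1) * m)"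
    using *[of "gcd d (x ^ m - 1)"] by simp
  show "gcd d ((x - 1) * m) dvd gcd d (x ^ m - 1)"
    using *[of "gcd d ((x - 1) * m)"] by simp
qed

text \<open>Take the largest divisor \<open>d\<close> of \<open>D\<close> up to \<open>M\<close>.
  Unless \<open>d = D\<close>, multiplying it by a prime factor of \<open>D div d\<close> gives a
  divisor beyond \<open>M\<close>, and that prime is at most \<open>q\<close>.\<close>

lemma supported_on_divisor_near:
  fixes M q :: real
  assumes "supported_on P D" "\<And>p. p \<in> P \<Longrightarrow> real p \<le> q" "q > 1" "1 \<le> M" "M \<le> D"
  obtains d where "d dvd D" "M / q < d" "real d \<le> M"
proof -
  define A where "A = {d. d dvd D \<and> real d \<le> M}"
  have "D > 0" using assms(1) by (rule supported_on_pos)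
  hence "finite A" unfolding A_def by (intro finite_subset[OF _ finite_divisors_nat]) auto
  have "1 \<in> A" using assms by (auto simp: A_def)
  define d where "d = Max A"
  have d: "d \<in> A" "\<And>d'. d' \<in> A \<Longrightarrow> d' \<le> d"
    unfolding d_def using \<open>finite A\<close> \<open>1 \<in> A\<close> by (auto intro: Max_in)
  have "M / q < d"
  proof (cases "d = D")
    case True
    have "M < D * q" using assms(3,5) \<open>D > 0\<close> mult_strict_left_mono[of 1 q "real D"] by linarith
    thus ?thesis using True \<open>q > 1\<close> by (simp add: field_simps)
  next
    case False
    obtain k where k: "D = d * k" using d by (auto simp: A_def)
    hence "k \<noteq> 1" using False by auto
    then obtain p where p: "prime p" "p dvd k" using prime_factor_nat by blast
    hence "p \<in> P" using assms(1) k supported_onD by (metis dvd_mult)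
    have "d > 0" using k \<open>D > 0\<close> by (auto intro: Nat.gr0I)
    have "d * p dvd D" using p k by auto
    moreover have "\<not> d * p \<le> d" using \<open>d > 0\<close> prime_gt_1_nat[OF p(1)] by auto
    ultimately have "\<not> real (d * p) \<le> M" using d(2)[of "d * p"] by (auto simp: A_def)
    hence "M < real d * real p" by simp
    also have "real d * real p \<le> d * q" using assms(2)[OF \<open>p \<in> P\<close>] by (intro mult_left_mono) auto
    finally show ?thesis using \<open>q > 1\<close> by (simp add: field_simps)
  qed
  thus ?thesis using that d by (auto simp: A_def)
qed

section \<open>Exponential sums of powers\<close>

definition unit_char :: "real \<Rightarrow> complex" where
  "unit_char t = cis (2 * pi * t)"

lemma norm_unit_char [simp]: "norm (unit_char t) = 1"
  by (simp add: unit_char_def)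

lemma unit_char_add: "unit_char (s + t) = unit_char s * unit_char t"
  by (simp add: unit_char_def cis_mult ring_distribs)

lemma unit_char_minus: "unit_char (- t) = cnj (unit_char t)"
  by (simp add: unit_char_def cis_cnj)

lemma unit_char_diff: "unit_char (s - t) = unit_char s * cnj (unit_char t)"
  using unit_char_add[of s "- t"] by (simp add: unit_char_minus)

lemma unit_char_Ints: "t \<in> \<int> \<Longrightarrow> unit_char t = 1"
  by (simp add: unit_char_def)

lemma unit_char_eq_1_iff: "unit_char t = 1 \<longleftrightarrow> t \<in> \<int>"
proof
  assume "unit_char t = 1"
  hence "cos (2 * pi * t) = 1" by (auto simp: unit_char_def complex_eq_iff)
  then obtain n :: int where "2 * pi * t = of_int n * 2 * pi"
    by (auto simp: cos_one_2pi_int)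
  thus "t \<in> \<int>" by auto
qed (rule unit_char_Ints)

lemma unit_char_cong:
  fixes x y D :: nat
  assumes "[x = y] (mod D)" "D > 0"
  shows "unit_char (real x / real D) = unit_char (real y / real D)"
proof -
  obtain k :: int where "int x = int y + int D * k"
    using assms(1) by (metis cong_iff_lin cong_int_iff cong_sym)
  hence "real_of_int (int x) = real_of_int (int y + int D * k)" by simp
  hence "real x / D = real y / D + of_int k" using \<open>D > 0\<close> by (simp add: field_simps)
  thus ?thesis by (simp add: unit_char_add unit_char_Ints)
qed

definition exp_sum :: "nat \<Rightarrow> nat \<Rightarrow> nat \<Rightarrow> nat \<Rightarrow> complex" where
  "exp_sum b a D N = (\<Sum>n<N. unit_char (real (a * b ^ n) / real D))"

lemma norm_exp_sum_le: "norm (exp_sum b a D N) \<le> N"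
  unfolding exp_sum_def by (rule order.trans[OF norm_sum]) simp

lemma exp_sum_add:
  "exp_sum b a D (M + N) = exp_sum b a D M + exp_sum b (a * b ^ M) D N"
  by (induction N) (simp_all add: exp_sum_def power_add mult_ac)

lemma exp_sum_cong:
  assumes "[a = a'] (mod D)" "D > 0"
  shows "exp_sum b a D N = exp_sum b a' D N"
  unfolding exp_sum_def
  by (intro sum.cong unit_char_cong cong_mult assms) auto

text \<open>The sum of length \<open>R + k\<close> is split once after \<open>k\<close> and once
  after \<open>R\<close> terms.\<close>

lemma exp_sum_shift_period:
  assumes "[b ^ R = 1] (mod D)" "D > 0"
  shows "exp_sum b (a * b ^ k) D R = exp_sum b a D R"
proof -
  have "exp_sum b a D k + exp_sum b (a * b ^ k) D R = exp_sum b a D (R + k)"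
    using exp_sum_add[of b a D k R] by (simp add: add.commute)
  also have "\<dots> = exp_sum b a D R + exp_sum b (a * b ^ R) D k"
    by (rule exp_sum_add)
  also have "exp_sum b (a * b ^ R) D k = exp_sum b a D k"
    using cong_mult[OF cong_refl[of a] assms(1)] assms(2) by (intro exp_sum_cong) auto
  finally show ?thesis by simp
qed

lemma sum_powers_root_of_unity_eq_0:
  fixes z :: "'a :: field"
  assumes "z ^ p = 1" "z \<noteq> 1"
  shows "(\<Sum>i<p. z ^ i) = 0"
  using assms by (simp add: sum_gp_strict)

text \<open>
  If \<open>b\<^sup>t\<close> is \<open>1\<close> modulo \<open>D div p\<close> but not modulo \<open>D\<close>, multiplication by \<open>b\<^sup>t\<close> permutes the
  terms of a full period and multiplies each of them by a \<open>p\<close>-th root of unity other than \<open>1\<close>.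
\<close>

lemma exp_sum_period_eq_0:
  assumes "[b ^ R = 1] (mod D)" "coprime a D" "coprime b D" "prime p" "p dvd D" "D > 0"
    and "[b ^ t = 1] (mod (D div p))" "\<not> [b ^ t = 1] (mod D)" "[b ^ t = 1] (mod p)"
  shows "exp_sum b a D R = 0"
proof -
  define f where "f n = unit_char (real (a * b ^ n) / real D)" for n
  \<comment> \<open>This is the ratio of \<open>f (n + t)\<close> to \<open>f n\<close>.\<close>
  define z where "z n = unit_char (real (a * b ^ n) * (real (b ^ t) - 1) / real D)" for n
  define d where "d = D div p"
  have D: "D = p * d" using \<open>p dvd D\<close> by (simp add: d_def)
  have "d > 0" "p > 0" using D \<open>D > 0\<close> by auto
  obtain u :: int where u: "int (b ^ t) = 1 + int d * u"
    using assms(7) unfolding d_def[symmetric] by (metis cong_iff_lin cong_int_iff cong_sym of_nat_1)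
  have "real_of_int (int (b ^ t)) = real_of_int (1 + int d * u)" using u by simp
  hence u': "real (b ^ t) - 1 = d * of_int u" by simp
  have zu: "z n = unit_char (real (a * b ^ n) * of_int u / real p)" for n
    using D \<open>d > 0\<close> \<open>p > 0\<close> by (simp add: z_def u' mult.assoc del: of_nat_power)
  have "\<not> int p dvd u"
  proof
    assume "int p dvd u"
    hence "int D dvd int (b ^ t) - 1" using u D by auto
    hence "[int (b ^ t) = int 1] (mod int D)" by (simp add: cong_iff_dvd_diff)
    thus False using assms(8) by (simp only: cong_int_iff)
  qed
  \<comment> \<open>By \<open>zu\<close>, \<open>z n\<close> depends only on \<open>b ^ n\<close>
    modulo \<open>p\<close>, and \<open>b ^ t\<close> is 1 modulo \<open>p\<close>. Hence the ratio
    is constant along the progression \<open>n + t * i\<close>, whose terms are geometric.\<close>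
  have z_shift: "z (n + t * i) = z n" for n i
  proof -
    have "[b ^ (t * i) = 1] (mod p)" using cong_pow[OF assms(9), of i] by (simp add: power_mult)
    then obtain k :: int where k: "int (b ^ (t * i)) = 1 + int p * k"
      by (metis cong_iff_lin cong_int_iff cong_sym of_nat_1)
    have "real_of_int (int (b ^ (t * i))) = real_of_int (1 + int p * k)" using k by simp
    hence "real (b ^ (t * i)) = 1 + real p * of_int k" by simp
    hence "real (a * b ^ (n + t * i)) * of_int u / real p
             = real (a * b ^ n) * of_int u / real p + of_int (int (a * b ^ n) * u * k)"
      using \<open>p > 0\<close> by (simp add: power_add field_simps)
    thus ?thesis by (simp only: zu unit_char_add unit_char_Ints Ints_of_int mult_1_right)
  qed
  have fz: "f (n + t * i) = f n * z n ^ i" for n i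
  proof (induction i)
    case (Suc i)
    have "real (a * b ^ (n + t * Suc i)) / D
            = real (a * b ^ (n + t * i)) / D + real (a * b ^ (n + t * i)) * (real (b ^ t) - 1) / D"
      by (simp add: power_add algebra_simps diff_divide_distrib)
    hence "f (n + t * Suc i) = f (n + t * i) * z (n + t * i)"
      unfolding f_def z_def by (simp only: unit_char_add)
    thus ?case using Suc z_shift by simp
  qed simp
  have "(\<Sum>i<p. z n ^ i) = 0" for n
  proof (rule sum_powers_root_of_unity_eq_0)
    have "z n ^ p = unit_char (real p * (real (a * b ^ n) * of_int u / real p))"
      unfolding zu unit_char_def Complex.DeMoivre by (simp only: mult_ac)
    also have "real p * (real (a * b ^ n) * of_int u / real p) = of_int (int (a * b ^ n) * u)"
      using \<open>p > 0\<close> by simp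
    finally show "z n ^ p = 1" by (simp only: unit_char_Ints Ints_of_int)
    show "z n \<noteq> 1"
    proof
      assume "z n = 1"
      then obtain k :: int where "real (a * b ^ n) * of_int u / real p = of_int k"
        by (auto simp: zu unit_char_eq_1_iff elim: Ints_cases)
      hence "real_of_int (int (a * b ^ n) * u) = of_int (int p * k)"
        using \<open>p > 0\<close> by (simp add: field_simps)
      hence "int (a * b ^ n) * u = int p * k" by (simp only: of_int_eq_iff)
      hence "int p dvd int (a * b ^ n) * u" by simp
      moreover have "coprime p (a * b ^ n)"
        using assms(2,3,5) coprime_divisors[of p D] 
        by (metis coprime_commute coprime_divisors coprime_mult_right_iff coprime_power_right_iff
            dvd_refl)
      hence "coprime (int p) (int (a * b ^ n))" by (simp only: coprime_int_iff)
      ultimately show False using \<open>\<not> int p dvd u\<close> coprime_dvd_mult_right_iff by blast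
    qed
  qed
  moreover have "(\<Sum>n<R. f (n + t * i)) = exp_sum b a D R" for i
    using exp_sum_shift_period[OF assms(1) \<open>D > 0\<close>, of a "t * i"]
    by (simp add: exp_sum_def f_def power_add mult_ac)
  \<comment> \<open>Double counting: the left side vanishes by the geometric sums, while the right
    side is \<open>p\<close> copies of the full-period sum.\<close>
  moreover have "(\<Sum>n<R. f n * (\<Sum>i<p. z n ^ i)) = (\<Sum>i<p. \<Sum>n<R. f (n + t * i))"
    unfolding sum_distrib_left fz by (rule sum.swap)
  ultimately have "of_nat p * exp_sum b a D R = 0" by simp
  thus ?thesis using \<open>p > 0\<close> by simp
qed

text \<open>Complete periods contribute nothing, so fewer than \<open>R\<close> terms of modulus 1
  remain.\<close>

lemma norm_exp_sum_le_period:
  assumes "[b ^ R = 1] (mod D)" "D > 0" "exp_sum b a D R = 0" "R > 0"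
  shows "norm (exp_sum b a D N) \<le> R"
proof (induction N rule: less_induct)
  case (less N)
  show ?case
  proof (cases "N < R")
    case True
    thus ?thesis using norm_exp_sum_le[of b a D N] by linarith
  next
    case False
    have "exp_sum b a D N = exp_sum b a D R + exp_sum b (a * b ^ R) D (N - R)"
      using exp_sum_add[of b a D R "N - R"] False by simp
    also have "exp_sum b (a * b ^ R) D (N - R) = exp_sum b a D (N - R)"
      using cong_mult[OF cong_refl[of a] assms(1)] assms(2) by (intro exp_sum_cong) auto
    finally show ?thesis using less[of "N - R"] False assms(3,4) by simp
  qed
qed

section \<open>Periods of powers of b and sums over complete periods\<close>

locale base_period =
  fixes b :: nat and P :: "nat set" and T0 :: nat
  assumes b_gt_1: "b > 1"
    and T0_pos: "T0 > 0"
    and prime_P: "p \<in> P \<Longrightarrow> prime p"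
    and cong_P: "p \<in> P \<Longrightarrow> [b ^ T0 = 1] (mod p\<^sup>2)"
begin

text \<open>The bounded loss in lifting the exponent: for \<open>d\<close> supported on
  \<open>P\<close>, the order of \<open>b ^ T0\<close> modulo \<open>d\<close> is
  \<open>d div gcd d G\<close>.\<close>

definition G :: nat where "G = b ^ T0 - 1"

lemma power_T0_gt_1: "b ^ T0 > 1"
  using b_gt_1 T0_pos by (intro one_less_power) auto

lemma G_pos: "G > 0"
  using power_T0_gt_1 by (simp add: G_def)

lemma cong_power_T0:
  assumes "supported_on P d" "m > 0"
  shows "[b ^ (T0 * m) = 1] (mod d) \<longleftrightarrow> d dvd G * m"
proof -
  have "(b ^ T0) ^ m > 0" using b_gt_1 by simp
  hence "[b ^ (T0 * m) = 1] (mod d) \<longleftrightarrow> d dvd (b ^ T0) ^ m - 1"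
    by (subst cong_altdef_nat) (auto simp: power_mult)
  also have "\<dots> \<longleftrightarrow> d dvd G * m"
    unfolding G_def using assms prime_P cong_P power_T0_gt_1
    by (intro dvd_power_minus_one_iff) auto
  finally show ?thesis .
qed

text \<open>A common prime would lie in \<open>P\<close>, and so divide both \<open>b ^ T0\<close>
  and \<open>b ^ T0 - 1\<close>.\<close>

lemma coprime_base: "supported_on P D \<Longrightarrow> coprime b D"
proof (rule ccontr)
  assume D: "supported_on P D" and "\<not> coprime b D"
  have "gcd b D \<noteq> 1" using \<open>\<not> coprime b D\<close> coprime_iff_gcd_eq_1 by blast
  then obtain r where "prime r" "r dvd gcd b D" using prime_factor_nat by blast
  hence r: "prime r" "r dvd b" "r dvd D" by auto
  hence "r \<in> P" using D supported_onD by blast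
  have "[b ^ T0 = 1] (mod r)"
    using cong_P[OF \<open>r \<in> P\<close>] by (rule cong_dvd_modulus_nat) simp
  moreover have "r dvd b ^ T0" using T0_pos by (intro dvd_trans[OF r(2) dvd_power]) simp
  ultimately have "r dvd 1" using cong_dvd_iff by blast
  thus False using r by simp
qed

text \<open>The order \<open>M = D div gcd D G\<close> of \<open>b ^ T0\<close> modulo
  \<open>D\<close> exceeds 1, so it has a prime factor \<open>p\<close>. With
  \<open>m = M div p\<close>, the power \<open>b ^ (T0 * m)\<close> is 1 modulo
  \<open>D div p\<close> but not modulo \<open>D\<close>, as the cancellation argument requires. The
  length \<open>T0 * D\<close> is a multiple of the period, not necessarily the least one.\<close>

lemma exp_sum_full_period:
  assumes D: "supported_on P D" and "coprime a D" "\<not> D dvd G"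
  shows "exp_sum b a D (T0 * D) = 0"
proof -
  have "D > 0" using D by (rule supported_on_pos)
  define g where "g = gcd D G"
  define M where "M = D div g"
  have DM: "D = g * M" by (simp add: M_def g_def)
  hence "M \<noteq> 1" using assms(3) by (metis g_def gcd_dvd2 mult_1_right)
  then obtain p where p: "prime p" "p dvd M" using prime_factor_nat by blast
  then obtain m where m: "M = p * m" by auto
  have "g > 0" "m > 0" "p > 0" using DM m \<open>D > 0\<close> by auto
  have pD: "p dvd D" using p DM by simp
  hence "p \<in> P" using D p supported_onD by blast
  have dvd_iff: "D dvd G * k \<longleftrightarrow> M dvd k" for k
  proof -
    obtain G' where G': "G = g * G'" using g_def by (metis dvdE gcd_dvd2)
    have "coprime M G'"
    proof -
      have "coprime (D div gcd D G) (G div gcd D G)"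
        using \<open>D > 0\<close> by (intro div_gcd_coprime) auto
      moreover have "G div g = G'" using G' \<open>g > 0\<close> by simp
      ultimately show ?thesis unfolding M_def g_def by simp
    qed
    have "D dvd G * k \<longleftrightarrow> g * M dvd g * (G' * k)"
      using DM G' by (simp add: mult_ac)
    also have "\<dots> \<longleftrightarrow> M dvd G' * k" using \<open>g > 0\<close> by simp
    also have "\<dots> \<longleftrightarrow> M dvd k" using \<open>coprime M G'\<close> by (simp add: coprime_dvd_mult_right_iff)
    finally show ?thesis .
  qed
  show ?thesis
  proof (rule exp_sum_period_eq_0[where t = "T0 * m" and p = p])
    show "[b ^ (T0 * D) = 1] (mod D)" using cong_power_T0[OF D \<open>D > 0\<close>] by simp
    show "coprime b D" using D by (rule coprime_base)
    show "\<not> [b ^ (T0 * m) = 1] (mod D)"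
      using cong_power_T0[OF D \<open>m > 0\<close>] dvd_iff m \<open>m > 0\<close> prime_gt_1_nat[OF \<open>prime p\<close>]
      by (simp add: dvd_imp_le)
    have Dp: "D div p = g * m" using DM m \<open>p > 0\<close> by simp
    moreover have "g dvd G" unfolding g_def by (rule gcd_dvd2)
    ultimately have "D div p dvd G * m" by (simp only: mult_dvd_mono dvd_refl)
    moreover have "supported_on P (D div p)"
      unfolding Dp by (rule supported_on_dvd[OF D]) (simp add: DM m)
    ultimately show "[b ^ (T0 * m) = 1] (mod (D div p))"
      using cong_power_T0 \<open>m > 0\<close> by blast
    have "[b ^ T0 = 1] (mod p)"
      using cong_P[OF \<open>p \<in> P\<close>] by (rule cong_dvd_modulus_nat) simp
    thus "[b ^ (T0 * m) = 1] (mod p)"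
      using cong_pow[of "b ^ T0" 1 p m] by (simp add: power_mult)
  qed fact+
qed

lemma norm_exp_sum_le_modulus:
  assumes D: "supported_on P D" and "coprime a D" "\<not> D dvd G"
  shows "norm (exp_sum b a D N) \<le> T0 * D"
proof -
  have "D > 0" using D by (rule supported_on_pos)
  moreover have "[b ^ (T0 * D) = 1] (mod D)" using cong_power_T0[OF D \<open>D > 0\<close>] by simp
  ultimately show ?thesis
    using norm_exp_sum_le_period[OF _ _ exp_sum_full_period[OF assms], of N] T0_pos by simp
qed

end

section \<open>The van der Corput inequality\<close>

lemma norm_sum_shift_le:
  fixes f :: "nat \<Rightarrow> 'a :: real_normed_vector"
  assumes "\<And>n. norm (f n) \<le> 1"
  shows "norm ((\<Sum>n<N. f n) - (\<Sum>n<N. f (n + k))) \<le> 2 * real k"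
proof (induction k)
  case (Suc k)
  have eq: "(\<Sum>n<N. f (n + k)) - (\<Sum>n<N. f (n + Suc k)) = f k - f (N + k)"
    by (induction N) (simp_all add: algebra_simps)
  have "norm ((\<Sum>n<N. f n) - (\<Sum>n<N. f (n + Suc k)))
          \<le> norm ((\<Sum>n<N. f n) - (\<Sum>n<N. f (n + k))) + norm (f k - f (N + k))"
    unfolding eq[symmetric] by (rule order.trans[OF _ norm_triangle_ineq]) simp
  also have "norm (f k - f (N + k)) \<le> 2"
    using norm_triangle_ineq4[of "f k" "f (N + k)"] assms[of k] assms[of "N + k"] by linarith
  finally show ?case using Suc by simp
qed simp

text \<open>Averaging over the shifts \<open>h * T\<close> changes the sum by at most
  \<open>2 * H * T\<close> in boundary terms. Cauchy-Schwarz over \<open>n\<close> then leaves the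
  correlations of pairs of shifts: the \<open>H\<close> diagonal pairs give \<open>1 / H\<close> and
  the others give \<open>V\<close>.\<close>

lemma van_der_Corput:
  fixes f :: "nat \<Rightarrow> complex" and V :: real
  assumes f: "\<And>n. norm (f n) \<le> 1" and "H > 0" "V \<ge> 0"
    and corr: "\<And>h h'. h < h' \<Longrightarrow> h' < H \<Longrightarrow>
      norm (\<Sum>n<N. f (n + h' * T) * cnj (f (n + h * T))) \<le> V * N"
  shows "norm (\<Sum>n<N. f n) \<le> 2 * real H * T + N * sqrt (1 / H + V)"
proof -
  define S where "S = (\<Sum>n<N. f n)"
  define g where "g n = (\<Sum>h<H. f (n + h * T))" for n
  define C where "C h h' = (\<Sum>n<N. f (n + h * T) * cnj (f (n + h' * T)))" for h h'
  have C_diag: "norm (C h h) \<le> N" for h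
  proof -
    have "norm (C h h) \<le> (\<Sum>n<N. 1)"
      unfolding C_def using f by (intro sum_norm_le) (simp add: norm_mult mult_le_one)
    thus ?thesis by simp
  qed
  have C_sym: "norm (C h' h) = norm (C h h')" for h h'
  proof -
    have "C h' h = cnj (C h h')" by (simp add: C_def mult.commute)
    thus ?thesis by (simp only: complex_mod_cnj)
  qed
  have C_off: "norm (C h h') \<le> V * N" if "h \<noteq> h'" "h < H" "h' < H" for h h'
  proof (cases "h < h'")
    case True
    hence "norm (C h' h) \<le> V * N" using corr that unfolding C_def by blast
    thus ?thesis using C_sym[of h h'] by linarith
  next
    case False
    thus ?thesis using corr[of h' h] that unfolding C_def by simp
  qed
  have "of_real (\<Sum>n<N. (norm (g n))\<^sup>2) = (\<Sum>n<N. g n * cnj (g n))"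
    by (simp only: of_real_sum complex_norm_square)
  also have "\<dots> = (\<Sum>n<N. \<Sum>h<H. \<Sum>h'<H. f (n + h * T) * cnj (f (n + h' * T)))"
    by (simp add: g_def sum_product)
  also have "\<dots> = (\<Sum>h<H. \<Sum>n<N. \<Sum>h'<H. f (n + h * T) * cnj (f (n + h' * T)))"
    by (rule sum.swap)
  also have "\<dots> = (\<Sum>h<H. \<Sum>h'<H. C h h')"
    unfolding C_def by (rule sum.cong[OF refl sum.swap])
  finally have "norm (\<Sum>h<H. \<Sum>h'<H. C h h') = norm (of_real (\<Sum>n<N. (norm (g n))\<^sup>2) :: complex)"
    by (rule arg_cong[where f = norm, OF sym])
  hence "(\<Sum>n<N. (norm (g n))\<^sup>2) = norm (\<Sum>h<H. \<Sum>h'<H. C h h')"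
    by (simp only: norm_of_real abs_of_nonneg sum_nonneg zero_le_power2)
  also have "\<dots> \<le> (\<Sum>h<H. \<Sum>h'<H. (if h' = h then real N else 0) + V * N)"
  proof (intro sum_norm_le)
    fix h h' assume "h \<in> {..<H}" "h' \<in> {..<H}"
    thus "norm (C h h') \<le> (if h' = h then real N else 0) + V * N"
      using C_diag[of h] C_off[of h h'] mult_nonneg_nonneg[OF \<open>V \<ge> 0\<close>, of "real N"]
      by (cases "h' = h") auto
  qed
  also have "\<dots> = H * N + H * (H * (V * N))"
    by (simp add: sum.distrib distrib_left)
  finally have sq: "(\<Sum>n<N. (norm (g n))\<^sup>2) \<le> H * N + H * (H * (V * N))" .
  \<comment> \<open>Cauchy-Schwarz against the constant sequence 1.\<close>
  have "(norm (\<Sum>n<N. g n))\<^sup>2 \<le> (\<Sum>n<N. norm (g n))\<^sup>2"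
    by (intro power_mono norm_sum) auto
  also have "\<dots> \<le> (\<Sum>n<N. (norm (g n))\<^sup>2) * N"
    using sum_squared_le_sum_of_squares[of "\<lambda>n. norm (g n)" "{..<N}"] by simp
  also have "\<dots> \<le> (H * N + H * (H * (V * N))) * N"
    using sq by (intro mult_right_mono) auto
  also have "\<dots> = (real H * N)\<^sup>2 * (1 / H + V)"
  proof -
    have eq: "real H * (1 / H + V) = 1 + H * V" using \<open>H > 0\<close> by (simp add: distrib_left)
    have "(real H * N)\<^sup>2 * (1 / H + V) = real H * N * N * (real H * (1 / H + V))"
      by (simp only: power2_eq_square mult_ac)
    thus ?thesis unfolding eq by (simp add: algebra_simps)
  qed
  finally have "norm (\<Sum>n<N. g n) \<le> sqrt ((real H * N)\<^sup>2 * (1 / H + V))"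
    by (rule real_le_rsqrt)
  hence g_le: "norm (\<Sum>n<N. g n) \<le> H * (N * sqrt (1 / H + V))"
    by (simp add: real_sqrt_mult)
  have "of_nat H * S - (\<Sum>n<N. g n) = (\<Sum>h<H. S - (\<Sum>n<N. f (n + h * T)))"
    unfolding g_def by (subst sum.swap) (simp add: sum_subtractf)
  also have "norm \<dots> \<le> (\<Sum>h<H. 2 * real H * T)"
  proof (intro sum_norm_le)
    fix h assume "h \<in> {..<H}"
    hence "h * T \<le> H * T" by (intro mult_right_mono) auto
    hence "real (h * T) \<le> real (H * T)" by (simp only: of_nat_le_iff)
    thus "norm (S - (\<Sum>n<N. f (n + h * T))) \<le> 2 * real H * T"
      using norm_sum_shift_le[of f N "h * T"] f unfolding S_def by simp
  qed
  finally have "norm (of_nat H * S - (\<Sum>n<N. g n)) \<le> H * (2 * real H * T)" by simp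
  hence "norm (of_nat H * S) \<le> H * (2 * real H * T) + H * (N * sqrt (1 / H + V))"
    using g_le norm_triangle_sub[of "of_nat H * S" "\<Sum>n<N. g n"] by linarith
  hence "H * norm S \<le> H * (2 * real H * T + N * sqrt (1 / H + V))"
    by (simp add: norm_mult ring_distribs)
  thus ?thesis unfolding S_def using \<open>H > 0\<close> by (simp only: mult_le_cancel_left_pos of_nat_0_less_iff)
qed

section \<open>Incomplete sums by iterated van der Corput steps\<close>

context base_period
begin

text \<open>
  Here \<open>j\<close> counts the van der Corput steps and \<open>z\<close> the shifts in each of them. The shift \<open>l\<close> can
  contribute an extra factor of at most \<open>G * l\<close> to the decrease of the modulus, and the bound
  \<open>G\<^sup>2 * M * z\<close> at which the iteration stops keeps the new modulus above \<open>G\<close>.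
\<close>

lemma norm_exp_sum_le_weyl:
  fixes q M :: real and z :: nat
  assumes q: "\<And>p. p \<in> P \<Longrightarrow> real p \<le> q" "q > 1" and "M \<ge> 1" "z > 0"
    and N: "2 * real T0 * real G ^ 2 * real z ^ 2 * M \<le> real N"
    and "supported_on P D" "coprime a D" "D > G"
    and "real D \<le> real G ^ 2 * M * z * (M / q) ^ j"
  shows "norm (exp_sum b a D N) \<le> 4 * real N * (1 / z) powr (1 / 2 ^ j)"
proof -
  \<comment> \<open>Below the stopping bound the complete-sum estimate \<open>T0 * D\<close> is
    already at most \<open>N / z\<close>. This serves \<open>j = 0\<close> and also an iteration
    that stops early.\<close>
  have base: "norm (exp_sum b a D N) \<le> 4 * real N * (1 / z) powr (1 / 2 ^ 0)"
    if D: "supported_on P D" "coprime a D" "D > G" "real D \<le> real G ^ 2 * M * z" for D a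
  proof -
    have "norm (exp_sum b a D N) \<le> T0 * D"
      using D by (intro norm_exp_sum_le_modulus) (use G_pos in \<open>auto dest: dvd_imp_le\<close>)
    also have "\<dots> \<le> T0 * (real G ^ 2 * M * z)"
      using D by (simp add: mult_left_mono)
    also have "\<dots> \<le> N / z"
    proof -
      have "T0 * (real G ^ 2 * M * z) * z \<le> 2 * real T0 * real G ^ 2 * real z ^ 2 * M"
        using \<open>M \<ge> 1\<close> by (simp add: power2_eq_square mult_ac)
      thus ?thesis using N \<open>z > 0\<close> by (simp add: field_simps)
    qed
    also have "\<dots> \<le> 4 * real N * (1 / z) powr (1 / 2 ^ 0)"
      using \<open>z > 0\<close> by (simp add: divide_right_mono)
    finally show ?thesis .
  qed
  show ?thesis using assms(6-)
  proof (induction j arbitrary: D a)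
  case 0
  thus ?case using base by auto
next
  case (Suc j D a)
  \<comment> \<open>The saving to be proved. The induction hypothesis saves \<open>w^2\<close> on
    each correlation, and the van der Corput square root turns this into \<open>w\<close>.\<close>
  define w where "w = (1 / real z) powr (1 / 2 ^ Suc j)"
  have w2: "(1 / real z) powr (1 / 2 ^ j) = w\<^sup>2"
    using \<open>z > 0\<close> by (simp add: w_def power2_eq_square flip: powr_add)
  have "w > 0" using \<open>z > 0\<close> by (simp add: w_def)
  moreover have "w \<le> 1" using \<open>z > 0\<close> by (auto simp: w_def intro: powr_le1)
  ultimately have "w\<^sup>2 \<le> w" by (simp add: power2_eq_square mult_left_le)
  have "1 / z \<le> w\<^sup>2"
  proof -
    have "(1 / real z) powr 1 \<le> (1 / real z) powr (1 / 2 ^ j)"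
      using \<open>z > 0\<close> by (intro powr_mono') auto
    thus ?thesis using \<open>z > 0\<close> by (simp add: w2)
  qed
  show ?case
  proof (cases "real D \<le> real G ^ 2 * M * z")
    case True
    have "norm (exp_sum b a D N) \<le> 4 * real N * (1 / z) powr (1 / 2 ^ 0)"
      using base Suc.prems True by auto
    also have "\<dots> \<le> 4 * real N * w"
      using \<open>z > 0\<close> \<open>1 / z \<le> w\<^sup>2\<close> \<open>w\<^sup>2 \<le> w\<close> by (intro mult_left_mono) auto
    finally show ?thesis by (simp only: w_def)
  next
    case False
    have "G \<ge> 1" "D > 0" using G_pos Suc.prems by auto
    have "M * 1 \<le> M * (real G ^ 2 * z)"
      using \<open>G \<ge> 1\<close> \<open>z > 0\<close> \<open>M \<ge> 1\<close> by (intro mult_left_mono mult_ge1_I) auto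
    hence "M \<le> D" using False by (simp add: mult_ac)
    then obtain d where d: "d dvd D" "M / q < d" "real d \<le> M"
      using supported_on_divisor_near[OF Suc.prems(1) q \<open>M \<ge> 1\<close>] by blast
    have "d > 0" using d(1) \<open>D > 0\<close> by (auto intro: Nat.gr0I)
    \<comment> \<open>With shifts by multiples of \<open>T0 * d\<close>, every correlation loses at
      least the factor \<open>d\<close> of its modulus.\<close>
    define T where "T = T0 * d"
    define f where "f n = unit_char (real (a * b ^ n) / real D)" for n
    have "norm (\<Sum>n<N. f n) \<le> 2 * real z * T + N * sqrt (1 / z + 4 * w\<^sup>2)"
    proof (rule van_der_Corput)
      fix h h' assume h: "h < h'" "h' < z"
      define l where "l = h' - h"
      have l: "l > 0" "l < z" "h' = h + l" using h by (auto simp: l_def)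
      define B where "B = b ^ (T0 * (d * l))"
      have "B > 0" using b_gt_1 by (simp add: B_def)
      define g where "g = gcd D (B - 1)"
      define D' where "D' = D div g"
      \<comment> \<open>Lifting the exponent controls the lost factor \<open>g\<close> from both
        sides: it is a multiple of \<open>d\<close> and at most \<open>G * d * l\<close>.\<close>
      have g: "g = gcd D (G * (d * l))"
        unfolding g_def B_def G_def power_mult[of b T0 "d * l"]
        by (rule gcd_power_minus_one[of P])
           (use Suc.prems(1) prime_P cong_P power_T0_gt_1 \<open>d > 0\<close> \<open>l > 0\<close> in auto)
      have "g > 0" using \<open>D > 0\<close> by (simp add: g_def)
      have D': "D = g * D'" by (simp add: D'_def g_def)
      obtain e where e: "B - 1 = g * e" using g_def by (metis dvdE gcd_dvd2)
      define a' where "a' = a * b ^ (h * T) * e"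
      have "coprime D' e"
      proof -
        have "coprime (D div gcd D (B - 1)) ((B - 1) div gcd D (B - 1))"
          using \<open>D > 0\<close> by (intro div_gcd_coprime) auto
        moreover have "(B - 1) div g = e" using e \<open>g > 0\<close> by simp
        ultimately show ?thesis unfolding D'_def g_def by simp
      qed
      have sup': "supported_on P D'"
        using supported_on_dvd[OF Suc.prems(1)] D' by simp
      have "coprime a D'" using Suc.prems(2) D' by simp
      hence cop': "coprime a' D'"
        using \<open>coprime D' e\<close> coprime_base[OF sup'] by (simp add: a'_def coprime_commute)
      have "g \<le> G * (d * l)"
        using g G_pos \<open>d > 0\<close> \<open>l > 0\<close> by (auto intro: dvd_imp_le)
      hence "real g \<le> real (G * (d * l))" by (simp only: of_nat_le_iff)
      also have "\<dots> = real G * (real d * real l)" by simp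
      also have "real d * real l \<le> M * z"
        using d l by (intro mult_mono) auto
      hence "real G * (real d * real l) \<le> real G * (M * z)"
        by (rule mult_left_mono) simp
      finally have "g \<le> G * (M * z)" .
      \<comment> \<open>As \<open>D\<close> exceeds \<open>G^2 * M * z\<close> and \<open>g\<close>
        is at most \<open>G * M * z\<close>, the new modulus \<open>D'\<close> stays above
        \<open>G\<close>.\<close>
      have "real G * (real G * (M * z)) < real g * real D'"
        using False D' by (simp add: power2_eq_square mult_ac)
      also have "\<dots> \<le> real G * (M * z) * real D'"
        using \<open>g \<le> G * (M * z)\<close> by (intro mult_right_mono) auto
      finally have "real G * (M * z) * real G < real G * (M * z) * real D'"
        by (simp add: mult_ac)
      hence "D' > G" using G_pos \<open>M \<ge> 1\<close> \<open>z > 0\<close>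
        by (simp add: mult_less_cancel_left_pos)
      have "d dvd g" using d g by simp
      hence "real d \<le> g" using \<open>g > 0\<close> by (auto intro: dvd_imp_le)
      \<comment> \<open>Since \<open>g\<close> is at least \<open>d\<close>, which exceeds
        \<open>M / q\<close>, one factor \<open>M / q\<close> of the bound on the modulus is used
        up.\<close>
      have "real D' * (M / q) \<le> real D' * real g"
        using d \<open>real d \<le> g\<close> by (intro mult_left_mono) auto
      also have "\<dots> \<le> real G ^ 2 * M * z * (M / q) ^ j * (M / q)"
        using Suc.prems(4) D' by (simp add: mult_ac)
      finally have D'_le: "real D' \<le> real G ^ 2 * M * z * (M / q) ^ j"
        by (rule mult_right_le_imp_le) (use \<open>M \<ge> 1\<close> \<open>q > 1\<close> in simp)
      \<comment> \<open>The difference of the two numerators is a multiple of \<open>g\<close>, so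
        each correlation is again an exponential sum of the same kind, with modulus
        \<open>D'\<close>.\<close>
      have ff: "f (n + h' * T) * cnj (f (n + h * T)) = unit_char (real (a' * b ^ n) / real D')" for n
      proof -
        have "n + h' * T = n + h * T + T0 * (d * l)"
          by (simp add: l T_def algebra_simps)
        hence "b ^ (n + h' * T) = b ^ (n + h * T) * B"
          by (simp only: B_def power_add)
        moreover have "B = g * e + 1" using \<open>B > 0\<close> e by linarith
        ultimately have "a * b ^ (n + h' * T) = a * b ^ (n + h * T) * (g * e + 1)"
          by (simp only: mult.assoc)
        also have "\<dots> = a * b ^ (n + h * T) + g * (a' * b ^ n)"
          by (simp add: a'_def power_add algebra_simps)
        finally have "a * b ^ (n + h' * T) = a * b ^ (n + h * T) + g * (a' * b ^ n)" .
        hence "real (a * b ^ (n + h' * T)) / D - real (a * b ^ (n + h * T)) / D = real (g * (a' * b ^ n)) / D"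
          by (simp only: of_nat_add add_divide_distrib)
        also have "\<dots> = real (a' * b ^ n) / D'"
          using \<open>g > 0\<close> by (simp add: D')
        finally show ?thesis unfolding f_def unit_char_diff[symmetric] by simp
      qed
      have "norm (exp_sum b a' D' N) \<le> 4 * real N * (1 / z) powr (1 / 2 ^ j)"
        by (rule Suc.IH) fact+
      thus "norm (\<Sum>n<N. f (n + h' * T) * cnj (f (n + h * T))) \<le> 4 * w\<^sup>2 * N"
        unfolding ff exp_sum_def w2 by (simp add: mult_ac)
    qed (use \<open>z > 0\<close> in \<open>auto simp: f_def\<close>)
    also have "2 * real z * T \<le> N * w"
    proof -
      have "2 * real z * T \<le> 2 * real z * (T0 * M)"
        using d by (simp add: T_def mult_left_mono)
      also have "\<dots> * 1 \<le> \<dots> * real G ^ 2"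
        using \<open>G \<ge> 1\<close> \<open>M \<ge> 1\<close> by (intro mult_left_mono) auto
      also have "\<dots> = (2 * real T0 * real G ^ 2 * real z ^ 2 * M) / z"
        using \<open>z > 0\<close> by (simp add: power2_eq_square)
      also have "\<dots> \<le> N / z"
        using N by (intro divide_right_mono) auto
      finally have "2 * real z * T \<le> N * (1 / z)" by simp
      also have "\<dots> \<le> N * w"
        using \<open>1 / z \<le> w\<^sup>2\<close> \<open>w\<^sup>2 \<le> w\<close> by (intro mult_left_mono) auto
      finally show ?thesis .
    qed
    \<comment> \<open>The radicand is at most \<open>5 * w^2\<close>. Together with the boundary
      term \<open>N * w\<close> this reproduces the constant 4 of the induction hypothesis.\<close>
    also have "N * sqrt (1 / z + 4 * w\<^sup>2) \<le> N * (3 * w)"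
    proof (intro mult_left_mono real_le_lsqrt)
      show "1 / z + 4 * w\<^sup>2 \<le> (3 * w)\<^sup>2"
      proof -
        have "(3 * w)\<^sup>2 = 9 * w\<^sup>2" by (simp add: power_mult_distrib)
        thus ?thesis using \<open>1 / z \<le> w\<^sup>2\<close> zero_le_power2[of w] by linarith
      qed
    qed (use \<open>w > 0\<close> in auto)
    finally have "norm (\<Sum>n<N. f n) \<le> 4 * real N * w" by (simp add: mult_ac)
    thus ?thesis unfolding f_def exp_sum_def w_def .
  qed
qed
qed

text \<open>With \<open>L = ln D\<close>, the saving is \<open>z\<close> to the power
  \<open>-1 / 2 ^ j\<close>. Here \<open>ln z\<close> is of order \<open>L / ln L\<close>, while
  \<open>2 ^ j\<close> is at most a constant times \<open>L powr (3 / 4)\<close>, so the saving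
  tends to 0. The threshold \<open>D0\<close> is uniform in \<open>a\<close> and
  \<open>N\<close>.\<close>

lemma exp_sum_small:
  fixes \<epsilon> \<delta> :: real
  assumes "finite P" "\<epsilon> > 0" "\<delta> > 0"
  obtains D0 :: nat where
    "\<And>D a N. supported_on P D \<Longrightarrow> coprime a D \<Longrightarrow> D \<ge> D0 \<Longrightarrow>
       \<delta> * exp ((1 + \<epsilon>) * ln D / ln (ln D)) \<le> real N \<Longrightarrow> norm (exp_sum b a D N) \<le> \<delta> * N"
proof -
  \<comment> \<open>A common upper bound for the primes in \<open>P\<close>; the summand 2 keeps it
    above 1 even for empty \<open>P\<close>.\<close>
  define q :: real where "q = 2 + (\<Sum>p\<in>P. real p)"
  have q: "real p \<le> q" if "p \<in> P" for p
    using member_le_sum[OF that, of real] \<open>finite P\<close> by (simp add: q_def)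
  have "q \<ge> 2" by (simp add: q_def sum_nonneg)
  define C where "C = 2 * real T0 * real G ^ 2 * q"
  \<comment> \<open>The conditions on \<open>L\<close> give, in turn: positive logarithms and
    \<open>D > G\<close>; room for the constant \<open>C / \<delta>\<close>; room for the rounding
    in \<open>z\<close>; and a final saving below \<open>\<delta> / 4\<close>.\<close>
  have ev: "eventually (\<lambda>L. L > 1 \<and> ln L > 1 \<and> L > ln G) at_top"
    by (intro eventually_conj eventually_gt_at_top; real_asymp)
  moreover have "eventually (\<lambda>L. C / \<delta> \<le> exp (\<epsilon> / 4 * (L / ln L))) at_top"
  proof -
    have "filterlim (\<lambda>L. exp (\<epsilon> / 4 * (L / ln L))) at_top at_top"
      using \<open>\<epsilon> > 0\<close> by real_asymp
    thus ?thesis by (simp add: filterlim_at_top)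
  qed
  moreover have "eventually (\<lambda>L. 2 \<le> exp (\<epsilon> / 16 * (L / ln L))) at_top"
  proof -
    have "filterlim (\<lambda>L. exp (\<epsilon> / 16 * (L / ln L))) at_top at_top"
      using \<open>\<epsilon> > 0\<close> by real_asymp
    thus ?thesis by (simp add: filterlim_at_top)
  qed
  moreover have "eventually (\<lambda>L. exp (- (\<epsilon> / 16 * (L / ln L)) * (1 / (2 * L powr (3 / 4)))) < \<delta> / 4) at_top"
  proof -
    have "((\<lambda>L. exp (- (\<epsilon> / 16 * (L / ln L)) * (1 / (2 * L powr (3 / 4))))) \<longlongrightarrow> 0) at_top"
      using \<open>\<epsilon> > 0\<close> by real_asymp
    thus ?thesis by (rule order_tendstoD) (use \<open>\<delta> > 0\<close> in simp)
  qed
  ultimately have "eventually (\<lambda>L. (L > 1 \<and> ln L > 1 \<and> L > ln G) \<and> C / \<delta> \<le> exp (\<epsilon> / 4 * (L / ln L)) \<and>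
      2 \<le> exp (\<epsilon> / 16 * (L / ln L)) \<and>
      exp (- (\<epsilon> / 16 * (L / ln L)) * (1 / (2 * L powr (3 / 4)))) < \<delta> / 4) at_top"
    by eventually_elim blast
  then obtain L0 where L0: "\<And>L. L \<ge> L0 \<Longrightarrow> (L > 1 \<and> ln L > 1 \<and> L > ln G) \<and>
      C / \<delta> \<le> exp (\<epsilon> / 4 * (L / ln L)) \<and> 2 \<le> exp (\<epsilon> / 16 * (L / ln L)) \<and>
      exp (- (\<epsilon> / 16 * (L / ln L)) * (1 / (2 * L powr (3 / 4)))) < \<delta> / 4"
    by (auto simp: eventually_at_top_linorder)
  show ?thesis
  proof (rule that[of "nat \<lceil>exp L0\<rceil>"])
    fix D a N :: nat
    assume D: "supported_on P D" "coprime a D" "D \<ge> nat \<lceil>exp L0\<rceil>"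
      and N: "\<delta> * exp ((1 + \<epsilon>) * ln D / ln (ln D)) \<le> real N"
    define L where "L = ln (real D)"
    have "D > 0" using D(1) by (rule supported_on_pos)
    have expL: "exp L = D" using \<open>D > 0\<close> by (simp add: L_def)
    have "exp L0 \<le> exp L" using D(3) expL by linarith
    hence "L \<ge> L0" by simp
    note L = L0[OF this]
    have "exp L > exp (ln G)" using L by simp
    hence "D > G" using expL G_pos by simp
    define K where "K = L / ln L"
    have "K > 0" using L by (simp add: K_def)
    \<comment> \<open>The exponent \<open>(1 + \<epsilon>) * K\<close> available for
      \<open>N\<close> is spent as follows: \<open>(1 + \<epsilon> / 2) * K\<close> on
      \<open>M\<close>, \<open>\<epsilon> / 4 * K\<close> on \<open>z^2\<close>, and
      \<open>\<epsilon> / 4 * K\<close> on the constant. The choice of \<open>M\<close> makes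
      \<open>(M / q) ^ j\<close> equal to \<open>D\<close>.\<close>
    define j where "j = nat \<lceil>ln L / (1 + \<epsilon> / 2)\<rceil>"
    define z where "z = nat \<lfloor>exp (\<epsilon> / 8 * K)\<rfloor>"
    define M where "M = q * exp (L / j)"
    have j_ge: "ln L / (1 + \<epsilon> / 2) \<le> j" unfolding j_def by linarith
    have "ln L / (1 + \<epsilon> / 2) > 0" using L \<open>\<epsilon> > 0\<close> by simp
    hence "j > 0" using j_ge by linarith
    have "L / j \<le> L / (ln L / (1 + \<epsilon> / 2))"
      using j_ge L \<open>ln L / (1 + \<epsilon> / 2) > 0\<close> \<open>j > 0\<close>
      by (intro divide_left_mono mult_pos_pos) auto
    hence Lj: "L / j \<le> (1 + \<epsilon> / 2) * K" by (simp add: K_def mult_ac)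
    have j_le: "j \<le> ln L + 1"
    proof -
      have "ln L * 1 \<le> ln L * (1 + \<epsilon> / 2)" using L \<open>\<epsilon> > 0\<close> by (intro mult_left_mono) auto
      hence "ln L / (1 + \<epsilon> / 2) \<le> ln L" using \<open>\<epsilon> > 0\<close> by (simp add: divide_le_eq)
      thus ?thesis unfolding j_def using \<open>ln L / (1 + \<epsilon> / 2) > 0\<close> by linarith
    qed
    \<comment> \<open>Rewrite \<open>2 powr ln L\<close> as \<open>L powr ln 2\<close>; the point is
      that \<open>ln 2\<close> is below \<open>3 / 4\<close>, and so below 1.\<close>
    have pow_j: "2 ^ j \<le> 2 * L powr (3 / 4)"
    proof -
      have "(2 :: real) ^ j = 2 powr j" by (simp add: powr_realpow)
      also have "\<dots> \<le> 2 powr (ln L + 1)" using j_le by (intro powr_mono) auto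
      also have "\<dots> = 2 * L powr (ln 2)"
        using L by (simp only: powr_add) (simp add: powr_def mult_ac)
      also have "L powr (ln 2) \<le> L powr (3 / 4)"
        using L ln2_le_25_over_36 by (intro powr_mono) auto
      finally show ?thesis by simp
    qed
    have e16: "exp (\<epsilon> / 8 * K) = exp (\<epsilon> / 16 * K) * exp (\<epsilon> / 16 * K)"
      by (simp flip: exp_add)
    \<comment> \<open>The slack between \<open>\<epsilon> / 8\<close> and
      \<open>\<epsilon> / 16\<close> pays for rounding down in \<open>z\<close>.\<close>
    have "exp (\<epsilon> / 16 * K) * 2 \<le> exp (\<epsilon> / 8 * K)"
      unfolding e16 using L by (intro mult_left_mono) (auto simp: K_def)
    moreover have "exp (\<epsilon> / 16 * K) \<ge> 2" using L by (simp add: K_def)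
    ultimately have z_ge: "exp (\<epsilon> / 16 * K) \<le> z" unfolding z_def by linarith
    hence "z > 0" using exp_gt_zero[of "\<epsilon> / 16 * K"] by linarith
    have z_le: "real z \<le> exp (\<epsilon> / 8 * K)"
      unfolding z_def using exp_gt_zero[of "\<epsilon> / 8 * K"] by linarith
    have "M \<ge> 1"
    proof -
      have "1 * 1 \<le> q * exp (L / j)" using \<open>q \<ge> 2\<close> L \<open>j > 0\<close> by (intro mult_mono) auto
      thus ?thesis by (simp add: M_def)
    qed
    have "2 * real T0 * real G ^ 2 * real z ^ 2 * M = C * (real z ^ 2 * exp (L / j))"
      by (simp add: C_def M_def mult_ac)
    also have "\<dots> \<le> C * (exp (\<epsilon> / 8 * K) ^ 2 * exp ((1 + \<epsilon> / 2) * K))"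
      using z_le Lj \<open>q \<ge> 2\<close> unfolding C_def by (intro mult_left_mono mult_mono power_mono) auto
    also have "\<dots> \<le> (\<delta> * exp (\<epsilon> / 4 * K)) * (exp (\<epsilon> / 8 * K) ^ 2 * exp ((1 + \<epsilon> / 2) * K))"
      using L \<open>\<delta> > 0\<close> by (intro mult_right_mono) (auto simp: K_def field_simps)
    also have "\<dots> = \<delta> * exp ((1 + \<epsilon>) * K)"
      by (simp add: power2_eq_square mult.assoc flip: exp_add) (simp add: algebra_simps)
    also have "\<dots> \<le> N" using N by (simp add: K_def L_def)
    finally have N': "2 * real T0 * real G ^ 2 * real z ^ 2 * M \<le> N" .
    have "(M / q) ^ j = exp (L / j) ^ j" using \<open>q \<ge> 2\<close> by (simp add: M_def)
    also have "\<dots> = D" using \<open>j > 0\<close> expL by (simp flip: exp_of_nat_mult)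
    finally have Mj: "(M / q) ^ j = D" .
    have "1 * 1 * 1 \<le> real G ^ 2 * M * z"
      using G_pos \<open>M \<ge> 1\<close> \<open>z > 0\<close> by (intro mult_mono) auto
    hence "1 * real D \<le> real G ^ 2 * M * z * (M / q) ^ j"
      unfolding Mj by (intro mult_right_mono) auto
    hence main: "norm (exp_sum b a D N) \<le> 4 * real N * (1 / z) powr (1 / 2 ^ j)"
      using D q \<open>q \<ge> 2\<close> \<open>M \<ge> 1\<close> \<open>z > 0\<close> N' \<open>D > G\<close>
      by (intro norm_exp_sum_le_weyl[where q = q and M = M]) auto
    have "(1 / z) powr (1 / 2 ^ j) \<le> exp (- (\<epsilon> / 16 * K)) powr (1 / 2 ^ j)"
      using z_ge \<open>z > 0\<close> by (intro powr_mono2) (auto simp: exp_minus field_simps)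
    also have "\<dots> \<le> exp (- (\<epsilon> / 16 * K)) powr (1 / (2 * L powr (3 / 4)))"
      using pow_j \<open>K > 0\<close> \<open>\<epsilon> > 0\<close> L by (intro powr_mono' divide_left_mono) auto
    also have "\<dots> = exp (- (\<epsilon> / 16 * K) * (1 / (2 * L powr (3 / 4))))"
      by (simp add: powr_def)
    also have "\<dots> \<le> \<delta> / 4" using L by (simp add: K_def)
    finally have "(1 / z) powr (1 / 2 ^ j) \<le> \<delta> / 4" .
    hence "4 * real N * (1 / z) powr (1 / 2 ^ j) \<le> 4 * real N * (\<delta> / 4)"
      by (rule mult_left_mono) simp
    thus "norm (exp_sum b a D N) \<le> \<delta> * N"
      using main by (simp add: mult_ac)
  qed
qed

end

section \<open>Reduced denominators and block sums\<close>

text \<open>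
  The prime \<open>q\<close> dividing \<open>c (k + 1) div c k\<close> may vary with \<open>k\<close>, but a prime whose exponent in \<open>c\<close>
  stays below \<open>B\<close> can occur only finitely often.
\<close>

lemma reduced_denominator_at_top:
  fixes P :: "nat set" and A c :: "nat \<Rightarrow> nat"
  assumes "finite P" and c: "\<And>k. supported_on P (c k)" "\<And>k. c k < c (Suc k)" "\<And>k. c k dvd c (Suc k)"
    and A: "\<And>k. \<exists>t. A (Suc k) = 1 + t * (c (Suc k) div c k)"
  shows "filterlim (\<lambda>k. c k div gcd (A k) (c k)) at_top at_top"
  unfolding filterlim_at_top
proof
  fix B :: nat
  \<comment> \<open>Truncation at \<open>B\<close> makes each \<open>s p\<close> bounded and
    increasing, hence eventually constant. A prime whose exponent still grows at that stage must
    already have exponent at least \<open>B\<close>.\<close>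
  define s where "s p k = min (multiplicity p (c k)) B" for p k
  have c_pos: "c k > 0" for k using c(1) supported_on_pos by blast
  have "eventually (\<lambda>k. s p (Suc k) = s p k) sequentially" if "p \<in> P" for p
  proof -
    have mono: "incseq (s p)"
      unfolding s_def
      by (intro incseq_SucI min.mono dvd_imp_multiplicity_le c order.refl) (use c_pos in auto)
    obtain K where K: "\<And>k. s p k \<le> s p K"
      using ex_has_greatest_nat[of "\<lambda>_. True" 0 "s p" "Suc B"] by (auto simp: s_def less_Suc_eq_le)
    have "s p (Suc k) = s p k" if "k \<ge> K" for k
      using K[of "Suc k"] incseqD[OF mono that] incseqD[OF mono, of k "Suc k"] by linarith
    thus ?thesis by (rule eventually_sequentiallyI[of K])
  qed
  hence "eventually (\<lambda>k. \<forall>p\<in>P. s p (Suc k) = s p k) sequentially"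
    using \<open>finite P\<close> by (intro eventually_ball_finite) auto
  hence "eventually (\<lambda>k. B \<le> c (Suc k) div gcd (A (Suc k)) (c (Suc k))) sequentially"
  proof eventually_elim
    case (elim k)
    obtain r where r: "c (Suc k) = c k * r" using c(3) by blast
    have "r \<noteq> 1" using r c(2)[of k] by auto
    then obtain q where q: "prime q" "q dvd r" using prime_factor_nat by blast
    hence "q \<in> P" using supported_onD[OF c(1)[of "Suc k"], of q] r by auto
    have "r > 0" using r c_pos[of "Suc k"] by (auto intro: Nat.gr0I)
    have "multiplicity q (c (Suc k)) = multiplicity q (c k) + multiplicity q r"
      unfolding r using \<open>prime q\<close> c_pos[of k] \<open>r > 0\<close>
      by (intro prime_elem_multiplicity_mult_distrib) auto
    moreover have "multiplicity q r > 0"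
      using q \<open>r > 0\<close> by (simp add: prime_multiplicity_gt_zero_iff)
    moreover have "s q (Suc k) = s q k" using elim \<open>q \<in> P\<close> by blast
    ultimately have B: "B \<le> multiplicity q (c (Suc k))" by (simp add: s_def min_def split: if_splits)
    define v where "v = multiplicity q (c (Suc k))"
    define g where "g = gcd (A (Suc k)) (c (Suc k))"
    define D where "D = c (Suc k) div g"
    have gD: "c (Suc k) = g * D" by (simp add: g_def D_def)
    have "D > 0" using gD c_pos[of "Suc k"] by (auto intro: Nat.gr0I)
    \<comment> \<open>\<open>A (Suc k)\<close> is 1 modulo \<open>r\<close>, and \<open>q\<close>
      divides \<open>r\<close>. Thus no factor \<open>q\<close> cancels, and all of
      \<open>q ^ v\<close> survives in the reduced denominator.\<close>
    have "\<not> q dvd A (Suc k)"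
    proof
      assume "q dvd A (Suc k)"
      moreover obtain t where "A (Suc k) = 1 + t * r"
        using A[of k] r c_pos[of k] by auto
      moreover have "q dvd t * r" using q by simp
      ultimately have "q dvd 1" using dvd_add_left_iff[of q "t * r" 1] by simp
      thus False using \<open>prime q\<close> by simp
    qed
    hence "\<not> q dvd g" using dvd_trans[of q g "A (Suc k)"] by (auto simp: g_def)
    hence "coprime (q ^ v) g" using \<open>prime q\<close> by (simp add: prime_imp_coprime)
    moreover have "q ^ v dvd g * D" using multiplicity_dvd[of q "c (Suc k)"] gD by (simp add: v_def)
    ultimately have "q ^ v dvd D" by (simp add: coprime_dvd_mult_right_iff)
    hence "q ^ v \<le> D" using \<open>D > 0\<close> by (rule dvd_imp_le)
    moreover have "v < q ^ v" using prime_gt_1_nat[OF \<open>prime q\<close>] by (intro power_gt_expt) auto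
    ultimately show ?case using B by (simp add: v_def D_def g_def)
  qed
  thus "eventually (\<lambda>k. B \<le> c k div gcd (A k) (c k)) sequentially"
    by (subst (asm) eventually_sequentially_Suc)
qed

lemma exp_sum_reduce:
  assumes "D > 0"
  shows "exp_sum b a D N = exp_sum b (a div gcd a D) (D div gcd a D) N"
proof -
  define g where "g = gcd a D"
  have "g > 0" using assms by (simp add: g_def)
  obtain a' D' where a': "a = g * a'" and D': "D = g * D'"
    unfolding g_def by (meson dvdE gcd_dvd1 gcd_dvd2)
  have "real (a * b ^ n) / D = real (a' * b ^ n) / real D'" for n
    using \<open>g > 0\<close> by (simp add: a' D')
  moreover have "a div g = a'" "D div g = D'" using \<open>g > 0\<close> by (simp_all add: a' D')
  ultimately show ?thesis unfolding g_def[symmetric] exp_sum_def by simp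
qed

text \<open>Used at logarithms of moduli: it transfers the growth hypothesis on \<open>c k\<close>
  to the reduced denominator, once that is at least \<open>exp (exp 1)\<close>.\<close>

lemma log_quotient_mono:
  fixes x y :: real
  assumes "exp 1 \<le> x" "x \<le> y"
  shows "x / ln x \<le> y / ln y"
proof -
  have "x > 1" using assms exp_ge_add_one_self[of 1] by linarith
  hence "ln x > 0" "ln y > 0" using assms by auto
  thus ?thesis using ln_x_over_x_mono[OF assms] \<open>x > 1\<close> assms by (simp add: field_simps)
qed

text \<open>Each block may have an error proportional to the length of the block before it, because
  the growth hypothesis compares the denominator in use on a block with the preceding gap. Summed
  over blocks, the two kinds of error are each at most \<open>\<delta> * N\<close>, up to a constant
  from the early blocks.\<close>

lemma weyl_sum_blocks:
  fixes x :: "nat \<Rightarrow> 'a :: real_normed_field" and m :: "nat \<Rightarrow> nat"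
  assumes m: "strict_mono m"
    and blocks: "\<And>\<delta> :: real. \<delta> > 0 \<Longrightarrow> eventually (\<lambda>k. \<forall>n \<le> m (Suc (Suc k)) - m (Suc k).
      norm (\<Sum>i<n. x (m (Suc k) + i)) \<le> \<delta> * n + \<delta> * (real (m (Suc k)) - m k)) sequentially"
  shows "(\<lambda>N. (\<Sum>n<N. x n) / of_nat N) \<longlonglongrightarrow> 0"
proof (rule tendstoI)
  fix e :: real assume "e > 0"
  define \<delta> where "\<delta> = e / 4"
  have "\<delta> > 0" using \<open>e > 0\<close> by (simp add: \<delta>_def)
  define W where "W N = norm (\<Sum>n<N. x n)" for N
  obtain K where K: "\<And>k n. k \<ge> K \<Longrightarrow> n \<le> m (Suc (Suc k)) - m (Suc k) \<Longrightarrow>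
      norm (\<Sum>i<n. x (m (Suc k) + i)) \<le> \<delta> * n + \<delta> * (real (m (Suc k)) - m k)"
    using blocks[OF \<open>\<delta> > 0\<close>] by (auto simp: eventually_sequentially)
  have step: "W (m (Suc k) + n) \<le> W (m (Suc k)) + (\<delta> * n + \<delta> * (real (m (Suc k)) - m k))"
    if "k \<ge> K" "n \<le> m (Suc (Suc k)) - m (Suc k)" for k n
  proof -
    have "(\<Sum>i<m (Suc k) + n. x i) = (\<Sum>i<m (Suc k). x i) + (\<Sum>i<n. x (m (Suc k) + i))"
      by (induction n) (simp_all add: algebra_simps)
    thus ?thesis unfolding W_def
      using K[OF that] norm_triangle_ineq[of "\<Sum>i<m (Suc k). x i" "\<Sum>i<n. x (m (Suc k) + i)"]
      by simp
  qed
  define C where "C = W (m (Suc K))"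
  have C: "W (m (Suc k)) \<le> C + \<delta> * (real (m (Suc k)) + m k)" if "k \<ge> K" for k
    using that
  proof (induction k rule: dec_induct)
    case base
    show ?case using \<open>\<delta> > 0\<close> by (simp add: C_def)
  next
    case (step k)
    have le: "m (Suc k) \<le> m (Suc (Suc k))" using m by (simp add: strict_mono_less_eq)
    have "W (m (Suc (Suc k))) \<le> W (m (Suc k)) +
        (\<delta> * (real (m (Suc (Suc k))) - m (Suc k)) + \<delta> * (real (m (Suc k)) - m k))"
      using \<open>\<And>k n. k \<ge> K \<Longrightarrow> n \<le> m (Suc (Suc k)) - m (Suc k) \<Longrightarrow>
        W (m (Suc k) + n) \<le> W (m (Suc k)) + (\<delta> * n + \<delta> * (real (m (Suc k)) - m k))\<close>
        [of k "m (Suc (Suc k)) - m (Suc k)"] step le by (simp add: of_nat_diff)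
    thus ?case using step by (simp add: algebra_simps)
  qed
  have bound: "W N \<le> C + 2 * \<delta> * N" if "N \<ge> m (Suc K)" for N
  proof -
    \<comment> \<open>The block containing \<open>N\<close>, possibly incomplete. Strict
      monotonicity gives \<open>k \<le> m k\<close>, so the candidates are bounded by
      \<open>N\<close>.\<close>
    define k where "k = (GREATEST k. m k \<le> N)"
    have ex: "m (Suc K) \<le> N" by fact
    have bd: "\<forall>k. m k \<le> N \<longrightarrow> k \<le> N"
      using strict_mono_imp_increasing[OF m] order.trans by blast
    have k1: "m k \<le> N" unfolding k_def using GreatestI_nat[of "\<lambda>k. m k \<le> N", OF ex] bd by blast
    have "Suc K \<le> k" unfolding k_def using Greatest_le_nat[of "\<lambda>k. m k \<le> N", OF ex] bd by blast
    then obtain l where l: "k = Suc l" "l \<ge> K" by (cases k) auto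
    have "N < m (Suc k)"
      using Greatest_le_nat[of "\<lambda>k. m k \<le> N" "Suc k"] bd unfolding k_def[symmetric]
      by (meson Suc_n_not_le_n not_le_imp_less)
    hence "W (m (Suc l) + (N - m (Suc l))) \<le> W (m (Suc l)) +
        (\<delta> * (N - m (Suc l)) + \<delta> * (real (m (Suc l)) - m l))"
      using l by (intro step) auto
    hence "W N \<le> W (m (Suc l)) + (\<delta> * (real N - m (Suc l)) + \<delta> * (real (m (Suc l)) - m l))"
      using k1 l by (simp add: of_nat_diff)
    also have "\<dots> \<le> C + \<delta> * (real (m (Suc l)) + N)"
      using C[OF l(2)] by (simp add: algebra_simps)
    also have "\<dots> \<le> C + \<delta> * (real N + N)"
      using k1 l \<open>\<delta> > 0\<close> by simp
    finally show ?thesis by simp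
  qed
  have "eventually (\<lambda>N. real N > C / \<delta>) sequentially"
    using filterlim_real_sequentially by (simp add: filterlim_at_top_dense)
  hence "eventually (\<lambda>N. W N / N < e) sequentially"
    using eventually_ge_at_top[of "m (Suc K)"] eventually_gt_at_top[of 0]
  proof eventually_elim
    case (elim N)
    hence "C < \<delta> * N" using \<open>\<delta> > 0\<close> by (simp add: field_simps)
    hence "W N < 3 * \<delta> * N" using bound[OF elim(2)] by simp
    also have "\<dots> \<le> e * N" using \<open>e > 0\<close> by (simp add: \<delta>_def)
    finally show ?case using elim by (simp add: field_simps)
  qed
  thus "eventually (\<lambda>N. dist ((\<Sum>n<N. x n) / of_nat N) 0 < e) sequentially"
    by (simp add: W_def norm_divide)
qed

section \<open>Tails and partial sums of the series\<close>

text \<open>The exponents \<open>m\<close> grow by at least 1 per step, so the terms are dominated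
  by a geometric series of ratio \<open>1 / b\<close>, which is at most \<open>1 / 2\<close>; this
  gives the factor 2.\<close>

lemma alpha_tail_bounds:
  fixes b :: nat and c m :: "nat \<Rightarrow> nat"
  assumes "b > 1" and m: "strict_mono m" and c: "\<And>k. c k > 0" "\<And>k. c k \<le> c (Suc k)"
  defines "u \<equiv> \<lambda>k. 1 / (real (c k) * real b ^ m (Suc k))"
  shows "summable u" "0 \<le> (\<Sum>i. u (i + k))" "(\<Sum>i. u (i + k)) \<le> 2 / (real (c k) * real b ^ m (Suc k))"
proof -
  have c_mono: "c k \<le> c (i + k)" for i k
    by (induction i) (use c(2) order.trans in auto)
  have m_ge: "m (Suc k) + i \<le> m (Suc (i + k))" for i k
  proof (induction i)
    case (Suc i)
    have "m (Suc (i + k)) < m (Suc (Suc i + k))" using m by (simp add: strict_mono_less)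
    thus ?case using Suc by simp
  qed simp
  have le: "u (i + k) \<le> u k * (1 / b) ^ i" for i k
  proof -
    have "real (c k) * real b ^ (m (Suc k) + i) \<le> real (c (i + k)) * real b ^ m (Suc (i + k))"
      using c_mono[of k i] m_ge[of k i] \<open>b > 1\<close> by (intro mult_mono power_increasing) auto
    hence "u (i + k) \<le> 1 / (real (c k) * real b ^ (m (Suc k) + i))"
      unfolding u_def using c(1)[of k] \<open>b > 1\<close> c(1)[of "i + k"] by (intro divide_left_mono mult_pos_pos) auto
    thus ?thesis by (simp add: u_def power_add power_one_over)
  qed
  have u_nonneg: "u i \<ge> 0" for i by (simp add: u_def)
  have geo: "summable (\<lambda>i. u k * (1 / real b) ^ i)" for k
    using \<open>b > 1\<close> by (intro summable_mult summable_geometric) auto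
  show "summable u"
    using le[of _ 0] u_nonneg by (intro summable_comparison_test'[OF geo[of 0]]) auto
  hence sum: "summable (\<lambda>i. u (i + k))" by (rule summable_ignore_initial_segment)
  show "0 \<le> (\<Sum>i. u (i + k))" using sum u_nonneg by (intro suminf_nonneg) auto
  have "(\<Sum>i. u (i + k)) \<le> (\<Sum>i. u k * (1 / real b) ^ i)"
    using le sum geo by (intro suminf_le) auto
  also have "\<dots> = u k * (1 / (1 - 1 / b))"
    using \<open>b > 1\<close> by (subst suminf_mult) (auto simp: suminf_geometric intro!: summable_geometric)
  also have "\<dots> \<le> u k * 2"
    using \<open>b > 1\<close> u_nonneg by (intro mult_left_mono) (auto simp: field_simps)
  finally show "(\<Sum>i. u (i + k)) \<le> 2 / (real (c k) * real b ^ m (Suc k))"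
    by (simp add: u_def)
qed

text \<open>The unreduced numerator, over the denominator \<open>c k\<close>, of
  \<open>b ^ m (Suc k)\<close> times the sum of the terms with indices up to
  \<open>k\<close>.\<close>

definition scaled_numerator :: "nat \<Rightarrow> (nat \<Rightarrow> nat) \<Rightarrow> (nat \<Rightarrow> nat) \<Rightarrow> nat \<Rightarrow> nat" where
  "scaled_numerator b c m k = (\<Sum>j\<le>k. b ^ (m (Suc k) - m (Suc j)) * (c k div c j))"

lemma dvd_chain:
  fixes c :: "nat \<Rightarrow> nat"
  assumes c: "\<And>k. c k dvd c (Suc k)" and "j \<le> k"
  shows "c j dvd c k"
  using \<open>j \<le> k\<close> by (induction k rule: dec_induct) (auto intro: dvd_trans c)

text \<open>The newest term contributes 1, and every older one contains the factor
  \<open>c (Suc k) div c k\<close>. This is the form of numerator that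
  \<open>reduced_denominator_at_top\<close> expects.\<close>

lemma scaled_numerator_Suc:
  assumes "\<And>k. c k > 0" "\<And>k. c k dvd c (Suc k)"
  shows "\<exists>t. scaled_numerator b c m (Suc k) = 1 + t * (c (Suc k) div c k)"
proof -
  define r where "r = c (Suc k) div c k"
  have "r dvd b ^ (m (Suc (Suc k)) - m (Suc j)) * (c (Suc k) div c j)" if "j \<le> k" for j
  proof -
    have "c (Suc k) div c j = (c k div c j) * r"
      unfolding r_def using dvd_chain[of c j k] assms that
      by (metis div_mult_swap dvd_div_mult dvd_div_mult_self mult.commute)
    thus ?thesis by simp
  qed
  hence "r dvd (\<Sum>j\<le>k. b ^ (m (Suc (Suc k)) - m (Suc j)) * (c (Suc k) div c j))"
    by (intro dvd_sum) auto
  then obtain t where "(\<Sum>j\<le>k. b ^ (m (Suc (Suc k)) - m (Suc j)) * (c (Suc k) div c j)) = r * t"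
    by blast
  thus ?thesis using assms(1)[of "Suc k"]
    by (intro exI[of _ t]) (simp add: scaled_numerator_def r_def mult.commute)
qed

lemma scaled_numerator_eq:
  fixes b :: nat and c m :: "nat \<Rightarrow> nat"
  assumes "b > 0" "strict_mono m" "\<And>k. c k > 0" "\<And>k. c k dvd c (Suc k)"
  shows "real b ^ m (Suc k) * (\<Sum>j<Suc k. 1 / (real (c j) * real b ^ m (Suc j)))
           = real (scaled_numerator b c m k) / real (c k)"
proof -
  have "real b ^ m (Suc k) * (1 / (real (c j) * real b ^ m (Suc j)))
          = real (b ^ (m (Suc k) - m (Suc j)) * (c k div c j)) / real (c k)" if "j \<le> k" for j
  proof -
    have "m (Suc j) \<le> m (Suc k)" using assms(2) that by (simp add: strict_mono_less_eq)
    hence "real b ^ m (Suc k) = real b ^ (m (Suc k) - m (Suc j)) * real b ^ m (Suc j)"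
      by (simp flip: power_add)
    moreover have "real (c k div c j) / real (c k) = 1 / real (c j)"
      using dvd_chain[of c j k] assms(3)[of j] assms(3)[of k] assms(4) that
      by (simp add: real_of_nat_div)
    moreover have "real (b ^ (m (Suc k) - m (Suc j)) * (c k div c j)) / real (c k)
        = real b ^ (m (Suc k) - m (Suc j)) * (real (c k div c j) / real (c k))"
      by simp
    ultimately show ?thesis using \<open>b > 0\<close> by simp
  qed
  thus ?thesis unfolding scaled_numerator_def sum_distrib_left of_nat_sum sum_divide_distrib
    by (intro sum.cong) auto
qed

context base_period
begin

text \<open>On the block, the argument of the character is \<open>a * b ^ i / c k\<close> plus a
  small tail. After reduction to denominator \<open>D\<close>, a long sum is small by
  \<open>exp_sum_small\<close>. A short one is bounded by its number of terms, which is small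
  against the preceding gap. Here \<open>c\<close> is indexed from 0, so \<open>c k\<close> belongs
  to \<open>m (Suc k)\<close>.\<close>

lemma alpha_block_sum:
  fixes c m :: "nat \<Rightarrow> nat" and h :: nat and \<epsilon> \<delta> :: real
  defines "\<alpha> \<equiv> \<Sum>k. 1 / (real (c k) * real b ^ m (Suc k))"
  assumes "finite P" and m: "strict_mono m"
    and c: "\<And>k. supported_on P (c k)" "\<And>k. c k < c (Suc k)" "\<And>k. c k dvd c (Suc k)"
    and "\<epsilon> > 0" "\<delta> > 0" "h > 0"
    and lim: "(\<lambda>k. exp ((1 + \<epsilon>) * ln (real (c k)) / ln (ln (real (c k))))
                / (real (m (Suc k)) - real (m k))) \<longlonglongrightarrow> 0"
  shows "eventually (\<lambda>k. \<forall>n \<le> m (Suc (Suc k)) - m (Suc k).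
     norm (\<Sum>i<n. unit_char (real h * (real b ^ (m (Suc k) + i) * \<alpha>)))
       \<le> \<delta> * n + \<delta> * (real (m (Suc k)) - m k)) sequentially"
proof -
  define u where "u k = 1 / (real (c k) * real b ^ m (Suc k))" for k
  define A where "A = scaled_numerator b c m"
  define E where "E x = exp ((1 + \<epsilon>) * x / ln x)" for x :: real
  define tail where "tail k = (\<Sum>i. u (i + Suc k))" for k
  have c_pos: "c k > 0" for k using c(1) supported_on_pos by blast
  have c_le: "c k \<le> c (Suc k)" for k using c(2)[of k] by simp
  have tails: "summable u" "0 \<le> (\<Sum>i. u (i + k))"
    "(\<Sum>i. u (i + k)) \<le> 2 / (real (c k) * real b ^ m (Suc k))" for k
    using alpha_tail_bounds[of b m c] b_gt_1 m c_pos c_le unfolding u_def by auto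
  obtain D0 where D0: "\<And>D a N. supported_on P D \<Longrightarrow> coprime a D \<Longrightarrow> D \<ge> D0 \<Longrightarrow>
       \<delta> / 2 * exp ((1 + \<epsilon>) * ln D / ln (ln D)) \<le> real N \<Longrightarrow> norm (exp_sum b a D N) \<le> \<delta> / 2 * N"
    using exp_sum_small[OF \<open>finite P\<close> \<open>\<epsilon> > 0\<close>, of "\<delta> / 2"] \<open>\<delta> > 0\<close> by auto
  \<comment> \<open>Multiplying the numerator by \<open>h\<close> can cancel at most a further
    factor \<open>h\<close> of the denominator. The value \<open>exp (exp 1)\<close> puts
    \<open>ln D\<close> in the range where \<open>x / ln x\<close> increases.\<close>
  define B where "B = h * max D0 (nat \<lceil>exp (exp 1) :: real\<rceil>)"
  have "filterlim (\<lambda>k. c k div gcd (A k) (c k)) at_top at_top"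
    using \<open>finite P\<close> c unfolding A_def
    by (intro reduced_denominator_at_top scaled_numerator_Suc) (auto simp: c_pos)
  hence ev1: "eventually (\<lambda>k. B \<le> c k div gcd (A k) (c k)) sequentially"
    by (simp add: filterlim_at_top)
  have ev2: "eventually (\<lambda>k. exp ((1 + \<epsilon>) * ln (real (c k)) / ln (ln (real (c k))))
                / (real (m (Suc k)) - real (m k)) < 1) sequentially"
    using lim by (rule order_tendstoD) simp
  have "isCont unit_char 0"
    unfolding unit_char_def cis_conv_exp by (intro continuous_intros)
  obtain \<eta> where \<eta>: "\<eta> > 0" "\<And>t. \<bar>t\<bar> < \<eta> \<Longrightarrow> norm (unit_char t - 1) < \<delta> / 2"
  proof -
    have "\<delta> / 2 > 0" using \<open>\<delta> > 0\<close> by simp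
    with \<open>isCont unit_char 0\<close> obtain d where "d > 0"
      "\<And>t. \<bar>t\<bar> < d \<Longrightarrow> norm (unit_char t - unit_char 0) < \<delta> / 2"
      unfolding continuous_at_eps_delta dist_norm by (metis diff_zero real_norm_def)
    thus ?thesis using that by (simp add: unit_char_def)
  qed
  have "strict_mono c" using c(2) by (simp add: strict_mono_Suc_iff)
  hence "filterlim (\<lambda>k. real (c k)) at_top sequentially"
    by (intro filterlim_compose[OF filterlim_real_sequentially] filterlim_subseq)
  hence ev3: "eventually (\<lambda>k. real (c k) > real h * 2 / \<eta>) sequentially"
    by (simp add: filterlim_at_top_dense)
  show ?thesis using ev1 ev2 ev3
  proof eventually_elim
    case (elim k)
    show ?case
    proof (intro allI impI)
      fix n assume n: "n \<le> m (Suc (Suc k)) - m (Suc k)"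
      have mk: "real (m (Suc k)) - real (m k) > 0" using m by (simp add: strict_mono_less)
      define a where "a = h * A k"
      define g where "g = gcd a (c k)"
      define D where "D = c k div g"
      define a' where "a' = a div g"
      have "g > 0" using c_pos by (simp add: g_def)
      have gD: "c k = g * D" by (simp add: D_def g_def)
      have D_pos: "D > 0" using gD c_pos[of k] by (auto intro: Nat.gr0I)
      have sup: "supported_on P D" using supported_on_dvd[OF c(1)[of k]] gD by simp
      have cop: "coprime a' D"
        unfolding a'_def D_def g_def using c_pos by (intro div_gcd_coprime) auto
      have "h * D \<ge> B"
      proof -
        define g' where "g' = gcd (A k) (c k)"
        have "g' > 0" using c_pos by (simp add: g'_def)
        have "g dvd gcd (h * A k) (h * c k)" by (simp add: g_def a_def)
        hence "g dvd h * g'" by (simp add: g'_def gcd_mult_distrib_nat)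
        hence "g \<le> h * g'" using \<open>g' > 0\<close> \<open>h > 0\<close> by (intro dvd_imp_le) auto
        have "g' * (c k div g') = c k" by (simp add: g'_def)
        hence "g' * (c k div g') = g * D" using gD by simp
        also have "\<dots> \<le> h * g' * D" using \<open>g \<le> h * g'\<close> by simp
        finally have "c k div g' \<le> h * D" using \<open>g' > 0\<close> by (simp add: mult_ac)
        thus ?thesis using elim(1) by (simp add: g'_def)
      qed
      hence D_ge: "D \<ge> D0" "D \<ge> nat \<lceil>exp (exp 1) :: real\<rceil>"
        using \<open>h > 0\<close> by (auto simp: B_def)
      have lnD: "exp 1 \<le> ln (real D)"
      proof -
        have "exp (exp 1) \<le> real D" using D_ge(2) by linarith
        thus ?thesis using D_pos by (simp add: ln_ge_iff)
      qed
      have "D \<le> c k" using gD \<open>g > 0\<close> by simp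
      hence "E (ln D) \<le> E (ln (c k))"
        using log_quotient_mono[OF lnD, of "ln (real (c k))"] D_pos \<open>\<epsilon> > 0\<close>
        unfolding E_def by (simp flip: times_divide_eq_right)
      also have "\<dots> \<le> real (m (Suc k)) - m k"
        using elim(2) mk by (simp add: E_def field_simps)
      finally have E_le: "E (ln D) \<le> real (m (Suc k)) - m k" .
      have main: "norm (exp_sum b a (c k) n) \<le> \<delta> / 2 * n + \<delta> / 2 * (real (m (Suc k)) - m k)"
      proof -
        have "exp_sum b a (c k) n = exp_sum b a' D n"
          unfolding a'_def D_def g_def by (rule exp_sum_reduce) (rule c_pos)
        moreover have "norm (exp_sum b a' D n) \<le> \<delta> / 2 * n + \<delta> / 2 * (real (m (Suc k)) - m k)"
        proof (cases "\<delta> / 2 * E (ln D) \<le> n")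
          case True
          hence "norm (exp_sum b a' D n) \<le> \<delta> / 2 * n"
            using D0[OF sup cop D_ge(1), of n] by (simp add: E_def)
          thus ?thesis using mk \<open>\<delta> > 0\<close> by (simp add: add_increasing2)
        next
          case False
          have "norm (exp_sum b a' D n) \<le> n" by (rule norm_exp_sum_le)
          also have "\<dots> \<le> \<delta> / 2 * E (ln D)" using False by simp
          also have "\<dots> \<le> \<delta> / 2 * (real (m (Suc k)) - m k)"
            using E_le \<open>\<delta> > 0\<close> by (intro mult_left_mono) auto
          finally show ?thesis using \<open>\<delta> > 0\<close> by (simp add: add_increasing)
        qed
        ultimately show ?thesis by simp
      qed
      define t where "t i = h * (real b ^ (m (Suc k) + i) * tail k)" for i
      have split: "h * (real b ^ (m (Suc k) + i) * \<alpha>) = real (a * b ^ i) / real (c k) + t i" for i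
      proof -
        have "\<alpha> = tail k + (\<Sum>j<Suc k. u j)"
          unfolding \<alpha>_def tail_def u_def[symmetric] using suminf_split_initial_segment[OF tails(1)] .
        moreover have "real b ^ m (Suc k) * (\<Sum>j<Suc k. u j) = real (A k) / real (c k)"
          unfolding u_def A_def using b_gt_1 by (intro scaled_numerator_eq m c_pos c) auto
        hence "real h * (real b ^ i * (real b ^ m (Suc k) * (\<Sum>j<Suc k. u j)))
            = real (a * b ^ i) / real (c k)"
          by (simp only: a_def) simp
        hence "real h * (real b ^ (m (Suc k) + i) * (\<Sum>j<Suc k. u j)) = real (a * b ^ i) / real (c k)"
          by (simp only: power_add mult_ac)
        ultimately show ?thesis by (simp only: t_def distrib_left add.commute)
      qed
      have t: "norm (unit_char (t i) - 1) \<le> \<delta> / 2" if "i < n" for i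
      proof -
        \<comment> \<open>Within the block the power of \<open>b\<close> does not exceed the one in
          the first tail term, so the scaled tail is at most \<open>2 / c (Suc k)\<close>.\<close>
        have i: "m (Suc k) + i \<le> m (Suc (Suc k))" using n that by simp
        have "real b ^ (m (Suc k) + i) * tail k
            \<le> real b ^ m (Suc (Suc k)) * (2 / (real (c (Suc k)) * real b ^ m (Suc (Suc k))))"
          unfolding tail_def using tails(2,3)[of "Suc k"] i b_gt_1
          by (intro mult_mono power_increasing) auto
        also have "\<dots> = 2 / real (c (Suc k))" using b_gt_1 by simp
        also have "\<dots> \<le> 2 / real (c k)"
          using c_le[of k] c_pos[of k] by (intro divide_left_mono mult_pos_pos) (auto simp: c_pos)
        finally have "t i \<le> h * (2 / real (c k))"
          unfolding t_def by (intro mult_left_mono) auto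
        also have "\<dots> < \<eta>"
          using elim(3) \<open>\<eta> > 0\<close> c_pos[of k] by (simp add: field_simps)
        finally have "t i < \<eta>" .
        moreover have "t i \<ge> 0" unfolding t_def tail_def using tails(2)[of "Suc k"] by simp
        ultimately show ?thesis using \<eta>(2)[of "t i"] by simp
      qed
      have "(\<Sum>i<n. unit_char (real h * (real b ^ (m (Suc k) + i) * \<alpha>)))
          = exp_sum b a (c k) n
            + (\<Sum>i<n. unit_char (real (a * b ^ i) / real (c k)) * (unit_char (t i) - 1))"
        unfolding split unit_char_add exp_sum_def sum.distrib[symmetric]
        by (intro sum.cong refl) (simp add: algebra_simps)
      also have "norm \<dots> \<le> norm (exp_sum b a (c k) n) + (\<Sum>i<n. \<delta> / 2)"
        by (intro order.trans[OF norm_triangle_ineq] add_left_mono sum_norm_le)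
           (use t in \<open>auto simp: norm_mult\<close>)
      also have "\<dots> \<le> (\<delta> / 2 * n + \<delta> / 2 * (real (m (Suc k)) - m k)) + \<delta> / 2 * n"
        using main by (simp add: mult_ac)
      also have "\<dots> \<le> \<delta> * n + \<delta> * (real (m (Suc k)) - m k)"
      proof -
        have "\<delta> / 2 * (real (m (Suc k)) - m k) \<le> \<delta> * (real (m (Suc k)) - m k)"
          using mk \<open>\<delta> > 0\<close> by (intro mult_right_mono) auto
        thus ?thesis by simp
      qed
      finally show "norm (\<Sum>i<n. unit_char (real h * (real b ^ (m (Suc k) + i) * \<alpha>)))
          \<le> \<delta> * n + \<delta> * (real (m (Suc k)) - m k)" .
    qed
  qed
qed

end

section \<open>Weyl's criterion\<close>

inductive trig_poly :: "(real \<Rightarrow> complex) \<Rightarrow> bool" where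
  trig_poly_char: "trig_poly (\<lambda>t. a * unit_char (of_int h * t))"
| trig_poly_add: "trig_poly f \<Longrightarrow> trig_poly g \<Longrightarrow> trig_poly (\<lambda>t. f t + g t)"

lemma trig_poly_const: "trig_poly (\<lambda>t. a)"
  using trig_poly_char[of a 0] by (simp add: unit_char_def)

lemma trig_poly_mult_char:
  "trig_poly f \<Longrightarrow> trig_poly (\<lambda>t. f t * (a * unit_char (of_int h * t)))"
proof (induction rule: trig_poly.induct)
  case (trig_poly_char a' h')
  have "(\<lambda>t. a' * unit_char (of_int h' * t) * (a * unit_char (of_int h * t)))
      = (\<lambda>t. (a' * a) * unit_char (of_int (h' + h) * t))"
    by (simp only: of_int_add ring_distribs unit_char_add mult_ac)
  thus ?case by (simp only: trig_poly.trig_poly_char)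
next
  case (trig_poly_add f g)
  thus ?case by (simp add: distrib_right trig_poly.trig_poly_add)
qed

lemma trig_poly_mult:
  assumes "trig_poly f" "trig_poly g"
  shows "trig_poly (\<lambda>t. f t * g t)"
  using assms(2)
proof (induction rule: trig_poly.induct)
  case (trig_poly_char a h)
  show ?case using assms(1) by (rule trig_poly_mult_char)
next
  case (trig_poly_add g1 g2)
  thus ?case by (simp add: distrib_left trig_poly.trig_poly_add)
qed

text \<open>On the unit circle a real-linear function is a combination of \<open>z\<close> and its
  conjugate, that is, of the frequencies 1 and -1. This makes the polynomials of Stone-Weierstrass
  trigonometric.\<close>

lemma trig_poly_real_polynomial_function:
  assumes "real_polynomial_function p"
  shows "trig_poly (\<lambda>t. complex_of_real (p (unit_char t)))"
  using assms
proof (induction rule: real_polynomial_function.induct)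
  case (linear f)
  interpret f: bounded_linear f by fact
  have eq: "complex_of_real (f (unit_char t))
      = (of_real (f 1) - \<i> * of_real (f \<i>)) / 2 * unit_char (of_int 1 * t)
        + (of_real (f 1) + \<i> * of_real (f \<i>)) / 2 * unit_char (of_int (- 1) * t)" for t
  proof -
    have "unit_char t = cos (2 * pi * t) *\<^sub>R 1 + sin (2 * pi * t) *\<^sub>R \<i>"
      by (simp add: unit_char_def complex_eq_iff)
    hence "f (unit_char t) = cos (2 * pi * t) * f 1 + sin (2 * pi * t) * f \<i>"
      by (simp add: f.add f.scaleR)
    thus ?thesis by (simp add: unit_char_def complex_eq_iff) (simp add: field_simps)
  qed
  show ?case unfolding eq by (rule trig_poly_add[OF trig_poly_char trig_poly_char])
next
  case (mult f g)
  thus ?case by (simp add: trig_poly_mult)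
next
  case (add f g)
  thus ?case by (simp add: trig_poly_add)
qed (rule trig_poly_const)

text \<open>For one character, integral and mean both vanish at nonzero frequency and both equal the
  coefficient at frequency 0. Negative frequencies follow from positive ones by conjugation.\<close>

lemma trig_poly_mean:
  fixes y :: "nat \<Rightarrow> real"
  assumes "trig_poly f"
    and weyl: "\<And>h :: nat. h > 0 \<Longrightarrow> (\<lambda>N. (\<Sum>n<N. unit_char (real h * y n)) / of_nat N) \<longlonglongrightarrow> 0"
  obtains I where "(f has_integral I) {0..1}" "(\<lambda>N. (\<Sum>n<N. f (y n)) / of_nat N) \<longlonglongrightarrow> I"
  using assms(1)
proof (induction arbitrary: thesis rule: trig_poly.induct)
  case (trig_poly_char a h)
  show ?case
  proof (cases "h = 0")
    case True
    have "(\<lambda>N. (\<Sum>n<N. a) / of_nat N) \<longlonglongrightarrow> a"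
      by (rule tendsto_eventually, rule eventually_mono[OF eventually_gt_at_top[of 0]]) simp
    moreover have "((\<lambda>t. a) has_integral a) {0..1::real}"
      using has_integral_const_real[of a 0 1] by simp
    ultimately show ?thesis using trig_poly_char[of a] True by (simp add: unit_char_def)
  next
    case False
    define w where "w = 2 * pi * of_int h * \<i>"
    have "w \<noteq> 0" using False by (simp add: w_def)
    have uc: "unit_char (of_int h * t) = exp (w * of_real t)" for t
      by (simp add: unit_char_def cis_conv_exp w_def mult_ac)
    have "((\<lambda>t. a * unit_char (of_int h * t)) has_integral (a * exp (w * of_real 1) / w - a * exp (w * of_real 0) / w)) {0..1}"
      unfolding uc using \<open>w \<noteq> 0\<close>
      by (intro fundamental_theorem_of_calculus)
         (auto intro!: derivative_eq_intros has_vector_derivative_real_field)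
    moreover have "exp w = 1" using uc[of 1] by (simp add: unit_char_Ints)
    ultimately have int: "((\<lambda>t. a * unit_char (of_int h * t)) has_integral 0) {0..1}"
      by simp
    have "(\<lambda>N. (\<Sum>n<N. unit_char (of_int h * y n)) / of_nat N) \<longlonglongrightarrow> 0"
    proof (cases "h > 0")
      case True
      thus ?thesis using weyl[of "nat h"] by simp
    next
      case neg: False
      have "(\<lambda>N. cnj ((\<Sum>n<N. unit_char (of_nat (nat (- h)) * y n)) / of_nat N)) \<longlonglongrightarrow> cnj 0"
        using neg False by (intro tendsto_cnj weyl) auto
      moreover have "cnj (unit_char (of_nat (nat (- h)) * t)) = unit_char (of_int h * t)" for t
        using neg by (simp flip: unit_char_minus)
      ultimately show ?thesis by simp
    qed
    hence "(\<lambda>N. a * ((\<Sum>n<N. unit_char (of_int h * y n)) / of_nat N)) \<longlonglongrightarrow> a * 0"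
      by (intro tendsto_mult_left)
    hence "(\<lambda>N. (\<Sum>n<N. a * unit_char (of_int h * y n)) / of_nat N) \<longlonglongrightarrow> 0"
      by (simp add: sum_distrib_left[symmetric])
    thus ?thesis using trig_poly_char int by blast
  qed
next
  case (trig_poly_add f g)
  obtain I where I: "(f has_integral I) {0..1}" "(\<lambda>N. (\<Sum>n<N. f (y n)) / of_nat N) \<longlonglongrightarrow> I"
    by (rule trig_poly_add.IH(1))
  obtain J where J: "(g has_integral J) {0..1}" "(\<lambda>N. (\<Sum>n<N. g (y n)) / of_nat N) \<longlonglongrightarrow> J"
    by (rule trig_poly_add.IH(2))
  show ?case
  proof (rule trig_poly_add.prems)
    show "((\<lambda>t. f t + g t) has_integral (I + J)) {0..1}"
      using I(1) J(1) by (rule has_integral_add)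
    show "(\<lambda>N. (\<Sum>n<N. f (y n) + g (y n)) / of_nat N) \<longlonglongrightarrow> I + J"
      using tendsto_add[OF I(2) J(2)] by (simp add: sum.distrib add_divide_distrib)
  qed
qed

text \<open>A polynomial within \<open>e / 3\<close> of \<open>F\<close> on the circle costs
  \<open>e / 3\<close> in the mean and \<open>e / 3\<close> in the integral. Taking \<open>F\<close>
  on the circle builds in periodicity modulo 1.\<close>

lemma weyl_mean_continuous:
  fixes y :: "nat \<Rightarrow> real" and F :: "complex \<Rightarrow> real"
  assumes weyl: "\<And>h :: nat. h > 0 \<Longrightarrow> (\<lambda>N. (\<Sum>n<N. unit_char (real h * y n)) / of_nat N) \<longlonglongrightarrow> 0"
    and F: "continuous_on (sphere 0 1) F"
  shows "(\<lambda>N. (\<Sum>n<N. F (unit_char (y n))) / real N) \<longlonglongrightarrow> integral {0..1} (\<lambda>t. F (unit_char t))"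
proof (rule tendstoI)
  fix e :: real assume "e > 0"
  define J where "J = integral {0..1} (\<lambda>t. F (unit_char t))"
  have "continuous_on {0..1} (\<lambda>t. F (unit_char t))"
    by (rule continuous_on_compose2[OF F])
       (auto simp: unit_char_def cis_conv_exp norm_exp_eq_Re intro!: continuous_intros)
  hence J: "((\<lambda>t. F (unit_char t)) has_integral J) {0..1}"
    unfolding J_def by (intro integrable_integral integrable_continuous_interval)
  obtain p where p: "real_polynomial_function p" "\<And>z. z \<in> sphere 0 1 \<Longrightarrow> \<bar>F z - p z\<bar> < e / 3"
    using Stone_Weierstrass_real_polynomial_function[OF compact_sphere F, of "e / 3"] \<open>e > 0\<close> by auto
  obtain I where I: "((\<lambda>t. complex_of_real (p (unit_char t))) has_integral I) {0..1}"
    "(\<lambda>N. (\<Sum>n<N. complex_of_real (p (unit_char (y n)))) / of_nat N) \<longlonglongrightarrow> I"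
    using trig_poly_mean[OF trig_poly_real_polynomial_function[OF p(1)] weyl] by blast
  have near: "\<bar>F (unit_char t) - p (unit_char t)\<bar> \<le> e / 3" for t
    using p(2)[of "unit_char t"] by simp
  have Re_int: "((\<lambda>t. p (unit_char t)) has_integral Re I) {0..1}"
    using has_integral_linear[OF I(1) bounded_linear_Re] by (simp add: o_def)
  have "((\<lambda>t. F (unit_char t) - p (unit_char t)) has_integral (J - Re I)) {0..1}"
    using J Re_int by (rule has_integral_diff)
  hence JI: "\<bar>J - Re I\<bar> \<le> e / 3"
    using has_integral_bound_real[of "e / 3" "{}" "\<lambda>t. F (unit_char t) - p (unit_char t)" "J - Re I" 0 1]
      near \<open>e > 0\<close> by simp
  have "(\<lambda>N. Re ((\<Sum>n<N. complex_of_real (p (unit_char (y n)))) / of_nat N)) \<longlonglongrightarrow> Re I"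
    using I(2) by (rule tendsto_Re)
  hence "(\<lambda>N. (\<Sum>n<N. p (unit_char (y n))) / real N) \<longlonglongrightarrow> Re I"
    by (simp only: Re_divide_of_nat Re_sum Re_complex_of_real)
  hence "eventually (\<lambda>N. dist ((\<Sum>n<N. p (unit_char (y n))) / real N) (Re I) < e / 3) sequentially"
    using \<open>e > 0\<close> by (intro tendstoD) auto
  thus "eventually (\<lambda>N. dist ((\<Sum>n<N. F (unit_char (y n))) / real N) J < e) sequentially"
  proof eventually_elim
    case (elim N)
    have "\<bar>(\<Sum>n<N. F (unit_char (y n))) / real N - (\<Sum>n<N. p (unit_char (y n))) / real N\<bar>
        = \<bar>\<Sum>n<N. F (unit_char (y n)) - p (unit_char (y n))\<bar> / N"
      by (simp add: sum_subtractf flip: diff_divide_distrib)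
    also have "\<dots> \<le> (\<Sum>n<N. e / 3) / N"
      using near by (intro divide_right_mono order.trans[OF sum_abs] sum_mono) auto
    also have "\<dots> \<le> e / 3" using \<open>e > 0\<close> by (cases "N = 0") auto
    finally show ?case using elim JI unfolding dist_real_def by linarith
  qed
qed

lemma unit_char_eq_iff: "unit_char s = unit_char t \<longleftrightarrow> s - t \<in> \<int>"
proof -
  have "unit_char s = unit_char (s - t) * unit_char t" using unit_char_add[of "s - t" t] by simp
  moreover have "unit_char t \<noteq> 0" by (simp add: unit_char_def)
  ultimately have "unit_char s = unit_char t \<longleftrightarrow> unit_char (s - t) = 1" by simp
  thus ?thesis by (simp add: unit_char_eq_1_iff)
qed

lemma unit_char_frac: "unit_char (frac t) = unit_char t"
  by (simp add: unit_char_eq_iff frac_def)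

text \<open>The indicator of a closed arc is the limit of continuous functions lying above it. Only
  an upper bound is sought; the lower bound will come from complementary cells.\<close>

lemma arc_frequency_le:
  fixes y :: "nat \<Rightarrow> real" and u v \<delta> :: real
  assumes weyl: "\<And>h :: nat. h > 0 \<Longrightarrow> (\<lambda>N. (\<Sum>n<N. unit_char (real h * y n)) / of_nat N) \<longlonglongrightarrow> 0"
    and "0 \<le> u" "u \<le> v" "v \<le> 1" "\<delta> > 0"
  shows "eventually (\<lambda>N. real (card {n. n < N \<and> frac (y n) \<in> {u..v}}) / N < v - u + \<delta>) sequentially"
proof -
  define K where "K = unit_char ` {u..v}"
  \<comment> \<open>Equal to 1 on the arc \<open>K\<close> and, for \<open>k > 0\<close>, to 0 at
    distance at least \<open>1 / k\<close> from it.\<close>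
  define F where "F k z = max 0 (1 - real k * infdist z K)" for k z
  define g where "g t = (if unit_char t \<in> K then 1 else 0 :: real)" for t
  have "continuous_on {u..v} unit_char"
    unfolding unit_char_def cis_conv_exp by (intro continuous_intros)
  hence "compact K" unfolding K_def by (intro compact_continuous_image) auto
  hence "closed K" by (rule compact_imp_closed)
  have "K \<noteq> {}" using \<open>u \<le> v\<close> by (auto simp: K_def)
  have F_cont: "continuous_on S (F k)" for S k
    unfolding F_def by (intro continuous_intros)
  have F_int: "(\<lambda>t. F k (unit_char t)) integrable_on {0..1}" for k
    by (intro integrable_continuous_interval continuous_on_compose2[OF F_cont[of UNIV]])
       (auto simp: unit_char_def cis_conv_exp intro!: continuous_intros)
  have F_bounds: "0 \<le> F k z" "F k z \<le> 1" for k z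
    by (auto simp: F_def infdist_nonneg)
  have F_lim: "(\<lambda>k. F k (unit_char t)) \<longlonglongrightarrow> g t" for t
  proof (cases "unit_char t \<in> K")
    case True
    thus ?thesis by (simp add: F_def g_def)
  next
    case False
    hence pos: "infdist (unit_char t) K > 0"
      using \<open>closed K\<close> \<open>K \<noteq> {}\<close> infdist_pos_not_in_closed by blast
    have "eventually (\<lambda>k. real k > 1 / infdist (unit_char t) K) sequentially"
      using filterlim_real_sequentially by (simp add: filterlim_at_top_dense)
    hence "eventually (\<lambda>k. F k (unit_char t) = g t) sequentially"
    proof eventually_elim
      case (elim k)
      thus ?case using pos False by (simp add: F_def g_def field_simps)
    qed
    thus ?thesis by (rule tendsto_eventually)
  qed
  have lim: "(\<lambda>k. integral {0..1} (\<lambda>t. F k (unit_char t))) \<longlonglongrightarrow> integral {0..1} g"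
    using F_int F_lim F_bounds
    by (intro dominated_convergence(2)[where h = "\<lambda>_. 1"]) auto
  have "((\<lambda>t. if t \<in> {u..v} then 1 else 0) has_integral (v - u)) {0..1}"
    using has_integral_const_real[of "1 :: real" u v] assms
    by (subst has_integral_restrict) auto
  hence "(g has_integral (v - u)) {0..1}"
  \<comment> \<open>The endpoints 0 and 1 are one point of the circle, so \<open>g\<close> can
    differ from the indicator of \<open>{u..v}\<close> there.\<close>
  proof (rule has_integral_spike[of "{0, 1}", rotated 2])
    show "negligible {0, 1 :: real}" by simp
    fix t :: real assume t: "t \<in> {0..1} - {0, 1}"
    have "unit_char t \<in> K \<longleftrightarrow> t \<in> {u..v}"
    proof
      assume "unit_char t \<in> K"
      then obtain s where s: "s \<in> {u..v}" "t - s \<in> \<int>" by (auto simp: K_def unit_char_eq_iff)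
      then obtain i :: int where i: "t - s = of_int i" by (auto elim: Ints_cases)
      hence "\<bar>real_of_int i\<bar> < 1" using s t assms by auto
      hence "i = 0" by linarith
      thus "t \<in> {u..v}" using i s by simp
    qed (simp add: K_def)
    thus "g t = (if t \<in> {u..v} then 1 else 0)" by (simp add: g_def)
  qed
  hence "integral {0..1} g = v - u" by (rule integral_unique)
  hence "eventually (\<lambda>k. integral {0..1} (\<lambda>t. F k (unit_char t)) < v - u + \<delta>) sequentially"
    using order_tendstoD(2)[OF lim, of "v - u + \<delta>"] \<open>\<delta> > 0\<close> by simp
  then obtain k where k: "integral {0..1} (\<lambda>t. F k (unit_char t)) < v - u + \<delta>"
    by (auto simp: eventually_sequentially)
  have "eventually (\<lambda>N. (\<Sum>n<N. F k (unit_char (y n))) / real N < v - u + \<delta>) sequentially"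
    using weyl_mean_continuous[OF weyl F_cont] k by (rule order_tendstoD)
  thus ?thesis
  proof eventually_elim
    case (elim N)
    have "{n. n < N \<and> frac (y n) \<in> {u..v}} = {..<N} \<inter> {n. frac (y n) \<in> {u..v}}" by auto
    hence "real (card {n. n < N \<and> frac (y n) \<in> {u..v}})
        = (\<Sum>n<N. if frac (y n) \<in> {u..v} then 1 else 0)"
      by (simp only: sum.If_cases finite_lessThan sum_constant sum.neutral_const)
    also have "\<dots> \<le> (\<Sum>n<N. F k (unit_char (y n)))"
    proof (intro sum_mono)
      fix n
      have "F k (unit_char (y n)) = 1" if "frac (y n) \<in> {u..v}"
        using that by (subst unit_char_frac[symmetric]) (simp add: F_def K_def)
      thus "(if frac (y n) \<in> {u..v} then 1 else 0) \<le> F k (unit_char (y n))"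
        using F_bounds by auto
    qed
    finally have "real (card {n. n < N \<and> frac (y n) \<in> {u..v}}) / N
        \<le> (\<Sum>n<N. F k (unit_char (y n))) / real N"
      by (rule divide_right_mono) simp
    thus ?case using elim by linarith
  qed
qed

section \<open>Digits\<close>

text \<open>The \<open>q\<close> cell frequencies sum to 1 and each is eventually below
  \<open>1 / q + \<delta>\<close>. Subtracting the other \<open>q - 1\<close> bounds from 1 yields
  the lower bound; \<open>\<delta> = e / q\<close> keeps the accumulated error below
  \<open>e\<close>.\<close>

lemma cell_frequency_tendsto:
  fixes y :: "nat \<Rightarrow> real" and q :: nat
  assumes weyl: "\<And>h :: nat. h > 0 \<Longrightarrow> (\<lambda>N. (\<Sum>n<N. unit_char (real h * y n)) / of_nat N) \<longlonglongrightarrow> 0"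
    and "j < q"
  shows "(\<lambda>N. real (card {n. n < N \<and> \<lfloor>frac (y n) * q\<rfloor> = int j}) / real N) \<longlonglongrightarrow> 1 / q"
proof (rule tendstoI)
  fix e :: real assume "e > 0"
  have "q > 0" using \<open>j < q\<close> by simp
  define \<delta> where "\<delta> = e / q"
  have "\<delta> > 0" using \<open>e > 0\<close> \<open>q > 0\<close> by (simp add: \<delta>_def)
  define f where "f i N = real (card {n. n < N \<and> \<lfloor>frac (y n) * q\<rfloor> = int i}) / real N" for i N
  have "eventually (\<lambda>N. f i N < 1 / q + \<delta>) sequentially" if "i < q" for i
  proof -
    define u v where "u = real i / q" and "v = (real i + 1) / q"
    have uv: "0 \<le> u" "u \<le> v" "v \<le> 1" "v - u = 1 / q"
      using \<open>q > 0\<close> \<open>i < q\<close> by (auto simp: u_def v_def field_simps)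
    have "eventually (\<lambda>N. real (card {n. n < N \<and> frac (y n) \<in> {u..v}}) / N < v - u + \<delta>) sequentially"
      by (rule arc_frequency_le) (use weyl uv \<open>\<delta> > 0\<close> in auto)
    thus ?thesis
    proof eventually_elim
      case (elim N)
      have "frac (y n) \<in> {u..v}" if "\<lfloor>frac (y n) * q\<rfloor> = int i" for n
        using that \<open>q > 0\<close> by (auto simp: u_def v_def field_simps floor_eq_iff)
      hence "card {n. n < N \<and> \<lfloor>frac (y n) * q\<rfloor> = int i} \<le> card {n. n < N \<and> frac (y n) \<in> {u..v}}"
        by (intro card_mono) auto
      hence "f i N \<le> card {n. n < N \<and> frac (y n) \<in> {u..v}} / real N"
        unfolding f_def by (intro divide_right_mono) auto
      thus ?case using elim uv(4) by linarith
    qed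
  qed
  hence "eventually (\<lambda>N. \<forall>i\<in>{..<q}. f i N < 1 / q + \<delta>) sequentially"
    by (intro eventually_ball_finite) auto
  hence "eventually (\<lambda>N. dist (f j N) (1 / q) < e) sequentially"
    using eventually_gt_at_top[of 0]
  proof eventually_elim
    case (elim N)
    have total: "(\<Sum>i<q. f i N) = 1"
    proof -
      have "{..<N} = (\<Union>i<q. {n. n < N \<and> \<lfloor>frac (y n) * q\<rfloor> = int i})"
      proof (intro equalityI subsetI)
        fix n assume n: "n \<in> {..<N}"
        have "0 \<le> \<lfloor>frac (y n) * q\<rfloor>" using frac_ge_0[of "y n"] by simp
        moreover have "frac (y n) * q < q" using frac_lt_1[of "y n"] \<open>q > 0\<close> by simp
        hence "\<lfloor>frac (y n) * q\<rfloor> < int q" by (simp add: floor_less_iff)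
        ultimately have "nat \<lfloor>frac (y n) * q\<rfloor> < q" "int (nat \<lfloor>frac (y n) * q\<rfloor>) = \<lfloor>frac (y n) * q\<rfloor>"
          by linarith+
        thus "n \<in> (\<Union>i<q. {n. n < N \<and> \<lfloor>frac (y n) * q\<rfloor> = int i})"
          using n by (intro UN_I[of "nat \<lfloor>frac (y n) * q\<rfloor>"]) auto
      qed auto
      hence "N = card (\<Union>i<q. {n. n < N \<and> \<lfloor>frac (y n) * q\<rfloor> = int i})"
        by (simp only: card_lessThan flip: \<open>{..<N} = _\<close>)
      also have "\<dots> = (\<Sum>i<q. card {n. n < N \<and> \<lfloor>frac (y n) * q\<rfloor> = int i})"
        by (intro card_UN_disjoint) auto
      finally have "real N = (\<Sum>i<q. real (card {n. n < N \<and> \<lfloor>frac (y n) * q\<rfloor> = int i}))"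
        by (simp only: of_nat_sum[symmetric] of_nat_eq_iff)
      thus ?thesis using elim(2) by (simp add: f_def flip: sum_divide_distrib)
    qed
    have "1 = f j N + (\<Sum>i\<in>{..<q} - {j}. f i N)"
      using total \<open>j < q\<close> by (simp add: sum.remove)
    also have "(\<Sum>i\<in>{..<q} - {j}. f i N) \<le> (\<Sum>i\<in>{..<q} - {j}. 1 / q + \<delta>)"
      using elim(1) by (intro sum_mono less_imp_le) auto
    also have "\<dots> = (real q - 1) * (1 / q + \<delta>)"
      using \<open>j < q\<close> by (simp add: of_nat_diff)
    also have "\<dots> = 1 - 1 / q + e - \<delta>"
      using \<open>q > 0\<close> by (simp add: \<delta>_def field_simps)
    finally have "1 / q - e < f j N" using \<open>\<delta> > 0\<close> by linarith
    moreover have "f j N < 1 / q + e"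
    proof -
      have "\<delta> \<le> e" using \<open>e > 0\<close> \<open>q > 0\<close> by (simp add: \<delta>_def field_simps)
      thus ?thesis using elim(1) \<open>j < q\<close> by (auto dest!: bspec[of _ _ j])
    qed
    ultimately show ?case unfolding dist_real_def by linarith
  qed
  thus "eventually (\<lambda>N. dist (real (card {n. n < N \<and> \<lfloor>frac (y n) * q\<rfloor> = int j}) / real N) (1 / q) < e) sequentially"
    unfolding f_def .
qed

definition digits_value :: "nat \<Rightarrow> nat list \<Rightarrow> nat" where
  "digits_value b s = foldl (\<lambda>v d. b * v + d) 0 s"

lemma digits_value_snoc: "digits_value b (s @ [d]) = b * digits_value b s + d"
  by (simp add: digits_value_def)

lemma digits_value_less:
  "set s \<subseteq> {0..<b} \<Longrightarrow> digits_value b s < b ^ length s"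
proof (induction s rule: rev_induct)
  case (snoc d s)
  hence "digits_value b s + 1 \<le> b ^ length s" by simp
  hence "b * (digits_value b s + 1) \<le> b * b ^ length s" by (rule mult_le_mono2)
  thus ?case using snoc.prems by (simp add: digits_value_snoc)
qed (simp add: digits_value_def)

lemma floor_mult_power_Suc_div:
  fixes x :: real and b :: nat
  assumes "b > 0"
  shows "\<lfloor>x * real b ^ Suc k\<rfloor> div int b = \<lfloor>x * real b ^ k\<rfloor>"
proof -
  have "\<lfloor>x * real b ^ Suc k / real_of_int (int b)\<rfloor> = \<lfloor>x * real b ^ Suc k\<rfloor> div int b"
    by (rule floor_divide_real_eq_div) simp
  moreover have "x * real b ^ Suc k / real_of_int (int b) = x * real b ^ k" using assms by simp
  ultimately show ?thesis by simp
qed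

text \<open>Induct by appending a digit: division of the next floor by \<open>b\<close> returns the
  previous floor, and the remainder is the new digit.\<close>

lemma digits_eq_iff_floor:
  fixes w :: real and b :: nat
  assumes "b > 1" "set s \<subseteq> {0..<b}" "0 \<le> w" "w < 1"
  shows "(\<forall>i\<in>{1..length s}. nat (\<lfloor>w * real b ^ i\<rfloor> mod int b) = s ! (i - 1))
      \<longleftrightarrow> \<lfloor>w * real b ^ length s\<rfloor> = int (digits_value b s)"
  using assms(2)
proof (induction s rule: rev_induct)
  case Nil
  thus ?case using assms by (simp add: digits_value_def floor_eq_iff)
next
  case (snoc d s)
  define F where "F k = \<lfloor>w * real b ^ k\<rfloor>" for k
  define k where "k = length s"
  have split: "{1..length (s @ [d])} = insert (Suc k) {1..length s}" by (auto simp: k_def)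
  have F_Suc: "F (Suc k) = int b * F k + F (Suc k) mod int b"
    unfolding F_def using floor_mult_power_Suc_div[of b w k] \<open>b > 1\<close>
    using mult_div_mod_eq[of "int b" "\<lfloor>w * real b ^ Suc k\<rfloor>"] by simp
  have mod_nonneg: "0 \<le> F (Suc k) mod int b" using \<open>b > 1\<close> by simp
  have "d < b" using snoc.prems by simp
  have key: "F k = int (digits_value b s) \<and> nat (F (Suc k) mod int b) = d
      \<longleftrightarrow> F (Suc k) = int b * int (digits_value b s) + int d"
  proof
    assume "F k = int (digits_value b s) \<and> nat (F (Suc k) mod int b) = d"
    thus "F (Suc k) = int b * int (digits_value b s) + int d" using F_Suc mod_nonneg by auto
  next
    assume "F (Suc k) = int b * int (digits_value b s) + int d"
    moreover have "(int b * V + int d) div int b = V" "(int b * V + int d) mod int b = int d" for V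
      using \<open>d < b\<close> by auto
    ultimately have "F (Suc k) div int b = int (digits_value b s)" "F (Suc k) mod int b = int d"
      by simp_all
    thus "F k = int (digits_value b s) \<and> nat (F (Suc k) mod int b) = d"
      using floor_mult_power_Suc_div[of b w k] \<open>b > 1\<close> by (simp add: F_def)
  qed
  have "(\<forall>i\<in>{1..length (s @ [d])}. nat (F i mod int b) = (s @ [d]) ! (i - 1)) \<longleftrightarrow>
     (\<forall>i\<in>{1..length s}. nat (F i mod int b) = s ! (i - 1)) \<and> nat (F (Suc k) mod int b) = d"
    unfolding split by (auto simp: k_def nth_append)
  also have "(\<forall>i\<in>{1..length s}. nat (F i mod int b) = s ! (i - 1)) \<longleftrightarrow> F k = int (digits_value b s)"
    unfolding F_def k_def using snoc by simp
  finally show ?case using key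
    unfolding F_def k_def by (simp add: digits_value_snoc)
qed

text \<open>The two scaled fractional parts differ by an integer multiple of \<open>b ^ i\<close>,
  and \<open>i > 0\<close> makes this a multiple of \<open>b\<close>, invisible to the
  digit.\<close>

lemma base_digit_add:
  assumes "b > 0" "i > 0"
  shows "base_digit b x (n + i) = nat (\<lfloor>frac (real b ^ n * x) * real b ^ i\<rfloor> mod int b)"
proof -
  define k :: int where "k = \<lfloor>real b ^ n * x\<rfloor> - \<lfloor>x\<rfloor> * int b ^ n"
  obtain j where i: "i = Suc j" using \<open>i > 0\<close> gr0_implies_Suc by blast
  have "frac x * real b ^ (n + i) = frac (real b ^ n * x) * real b ^ i + of_int (k * int b ^ j * int b)"
    by (simp add: frac_def k_def i power_add algebra_simps)
  hence "\<lfloor>frac x * real b ^ (n + i)\<rfloor> = \<lfloor>frac (real b ^ n * x) * real b ^ i\<rfloor> + k * int b ^ j * int b"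
    by (simp only: floor_add_int[symmetric])
  thus ?thesis unfolding base_digit_def by simp
qed

text \<open>The string \<open>s\<close> follows the first \<open>n\<close> digits exactly when the
  fractional part of \<open>b ^ n * x\<close> lies in cell \<open>digits_value b s\<close> of the
  \<open>b ^ length s\<close> equal cells of the unit interval.\<close>

lemma normal_in_base_weyl:
  fixes b :: nat and x :: real
  assumes "b > 1"
    and weyl: "\<And>h :: nat. h > 0 \<Longrightarrow>
      (\<lambda>N. (\<Sum>n<N. unit_char (real h * (real b ^ n * x))) / of_nat N) \<longlonglongrightarrow> 0"
  shows "normal_in_base b x"
  unfolding normal_in_base_def
proof (intro allI impI)
  fix s :: "nat list" assume s: "set s \<subseteq> {0..<b}"
  define w where "w n = frac (real b ^ n * x)" for n
  define q where "q = b ^ length s"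
  have digits: "(\<forall>i\<in>{1..length s}. base_digit b x (n + i) = s ! (i - 1))
      \<longleftrightarrow> \<lfloor>w n * q\<rfloor> = int (digits_value b s)" for n
  proof -
    have "(\<forall>i\<in>{1..length s}. base_digit b x (n + i) = s ! (i - 1))
      \<longleftrightarrow> (\<forall>i\<in>{1..length s}. nat (\<lfloor>w n * real b ^ i\<rfloor> mod int b) = s ! (i - 1))"
      using \<open>b > 1\<close> by (intro ball_cong) (simp_all add: base_digit_add w_def)
    also have "\<dots> \<longleftrightarrow> \<lfloor>w n * real b ^ length s\<rfloor> = int (digits_value b s)"
      using assms(1) s by (intro digits_eq_iff_floor) (simp_all add: w_def frac_lt_1)
    finally show ?thesis by (simp add: q_def)
  qed
  \<comment> \<open>Positions in the definition of normality start at 1, exponents of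
    \<open>b\<close> at 0.\<close>
  have "{n \<in> {1..N}. \<forall>i\<in>{1..length s}. base_digit b x (n - 1 + i) = s ! (i - 1)}
      = Suc ` {n. n < N \<and> \<lfloor>w n * q\<rfloor> = int (digits_value b s)}" for N
  proof (intro equalityI subsetI)
    fix n assume "n \<in> {n \<in> {1..N}. \<forall>i\<in>{1..length s}. base_digit b x (n - 1 + i) = s ! (i - 1)}"
    thus "n \<in> Suc ` {n. n < N \<and> \<lfloor>w n * q\<rfloor> = int (digits_value b s)}"
      unfolding digits by (intro image_eqI[of _ _ "n - 1"]) auto
  next
    fix n assume "n \<in> Suc ` {n. n < N \<and> \<lfloor>w n * q\<rfloor> = int (digits_value b s)}"
    thus "n \<in> {n \<in> {1..N}. \<forall>i\<in>{1..length s}. base_digit b x (n - 1 + i) = s ! (i - 1)}"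
      unfolding digits by auto
  qed
  moreover have "(\<lambda>N. real (card {n. n < N \<and> \<lfloor>w n * q\<rfloor> = int (digits_value b s)}) / real N) \<longlonglongrightarrow> 1 / q"
    unfolding w_def using digits_value_less[OF s]
    by (intro cell_frequency_tendsto weyl) (simp_all add: q_def)
  ultimately show "(\<lambda>N. real (card {n \<in> {1..N}. \<forall>i\<in>{1..length s}.
      base_digit b x (n - 1 + i) = s ! (i - 1)}) / real N) \<longlonglongrightarrow> 1 / real b ^ length s"
    by (simp add: card_image q_def)
qed

section \<open>Existence of the common period and conclusion of the proof\<close>

text \<open>Euler's theorem modulo the square of the product of \<open>P\<close> serves all primes
  at once.\<close>

lemma base_period_exists:
  assumes "b > 1" "finite P" "\<And>p. p \<in> P \<Longrightarrow> prime p \<and> coprime p b"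
  obtains T0 where "base_period b P T0"
proof
  define Q where "Q = (\<Prod>P)\<^sup>2"
  have "Q > 0" using assms prime_gt_0_nat by (auto simp: Q_def intro!: prod_pos)
  have cop: "coprime b Q"
    unfolding Q_def using assms by (auto intro!: prod_coprime_right simp: coprime_commute)
  show "base_period b P (totient Q)"
  proof
    fix p assume "p \<in> P"
    thus "prime p" using assms by blast
    have "p\<^sup>2 dvd Q" unfolding Q_def using \<open>p \<in> P\<close> \<open>finite P\<close> by (intro dvd_power_same dvd_prodI) auto
    thus "[b ^ totient Q = 1] (mod p\<^sup>2)"
      using euler_theorem[OF cop] cong_dvd_modulus_nat by blast
  qed (use \<open>b > 1\<close> \<open>Q > 0\<close> in auto)
qed

theorem theorem7p4:
  fixes b :: nat and P :: "nat set" and c m :: "nat \<Rightarrow> nat"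
  assumes "b > 1"
    and "finite P"
    and "\<And>p. p \<in> P \<Longrightarrow> prime p \<and> coprime p b"
    and "strict_mono_on {1..} c"
    and "\<And>k. k \<ge> 1 \<Longrightarrow> c k > 0"
    and "\<And>k p. k \<ge> 1 \<Longrightarrow> prime p \<Longrightarrow> p dvd c k \<Longrightarrow> p \<in> P"
    and "\<And>k. k \<ge> 1 \<Longrightarrow> c k dvd c (k + 1)"
    and "strict_mono_on {1..} m"
    and "\<And>k. k \<ge> 1 \<Longrightarrow> m k > 0"
    and "m 0 = 0"
    and "\<exists>\<epsilon>::real. \<epsilon> > 0 \<and>
           (\<lambda>k. exp ((1 + \<epsilon>) * ln (real (c k)) / ln (ln (real (c k))))
                  / (real (m k) - real (m (k - 1)))) \<longlonglongrightarrow> 0"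
  shows "normal_in_base b (alpha b c m)"
proof -
  obtain T0 where "base_period b P T0"
    using base_period_exists[OF assms(1-3)] by blast
  then interpret base_period b P T0 .
  obtain \<epsilon> :: real where \<epsilon>: "\<epsilon> > 0"
    "(\<lambda>k. exp ((1 + \<epsilon>) * ln (real (c k)) / ln (ln (real (c k))))
       / (real (m k) - real (m (k - 1)))) \<longlonglongrightarrow> 0"
    using assms(11) by blast
  define d where "d k = c (Suc k)" for k
  have lim: "(\<lambda>k. exp ((1 + \<epsilon>) * ln (real (d k)) / ln (ln (real (d k))))
       / (real (m (Suc k)) - real (m k))) \<longlonglongrightarrow> 0"
    using LIMSEQ_Suc[OF \<epsilon>(2)] by (simp add: d_def)
  \<comment> \<open>Monotonicity is assumed only from index 1 on; the step from 0 uses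
    \<open>m 0 = 0\<close> and \<open>m 1 > 0\<close>.\<close>
  have "m k < m (Suc k)" for k
  proof (cases "k = 0")
    case True
    thus ?thesis using assms(9)[of 1] assms(10) by simp
  next
    case False
    thus ?thesis by (intro strict_mono_onD[OF assms(8)]) auto
  qed
  hence m: "strict_mono m" by (simp add: strict_mono_Suc_iff)
  have d: "supported_on P (d k)" "d k < d (Suc k)" "d k dvd d (Suc k)" for k
    using assms(5)[of "Suc k"] assms(6)[of "Suc k"] assms(7)[of "Suc k"]
      strict_mono_onD[OF assms(4), of "Suc k" "Suc (Suc k)"]
    by (auto simp: supported_on_def prime_factors_dvd d_def)
  have \<alpha>: "alpha b c m = (\<Sum>k. 1 / (real (d k) * real b ^ m (Suc k)))"
    by (simp add: alpha_def d_def)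
  show ?thesis
  proof (rule normal_in_base_weyl[OF \<open>b > 1\<close>])
    fix h :: nat assume "h > 0"
    show "(\<lambda>N. (\<Sum>n<N. unit_char (real h * (real b ^ n * alpha b c m))) / of_nat N) \<longlonglongrightarrow> 0"
      unfolding \<alpha>
      by (rule weyl_sum_blocks[OF m])
         (rule alpha_block_sum[OF \<open>finite P\<close> m d \<open>\<epsilon> > 0\<close> _ \<open>h > 0\<close> lim])
  qed
qed

end
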